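(* Let $n,s$ be integers satisfying $s\leq \frac{n}{2^{17}\log n}$. Let $\mathcal{F}\subset \mathcal D_n$ be a family of derangements such that $\nu(\mathcal{F})<s$. Then $|\mathcal{F}|\leq (s-1)d_{n,1}$. Moreover, in the case of equality, $\mathcal{F}$ is of the form $\bigcup_{i=1}^{s-1}\mathcal D_n[(x,y_i)]$ or $\bigcup_{i=1}^{s-1}\mathcal D_n[(x_i,y)]$, where the $y_i$'s, respectively the $x_i$'s, are distinct and all the pairs $(x,y_i)$, respectively $(x_i,y)$, are off-diagonal (i.e. have distinct coordinates).
   Context: $\Sigma_n$ is the set of permutations of $[n]$; a permutation is identified with its graph $\{(i,\sigma(i))\}\subset[n]^2$, two permutations intersect iff they agree at some point, and $\nu(\mathcal{F})$ is the maximum number of pairwise non-intersecting members of $\mathcal{F}$. $\mathcal D_n$ is the set of derangements (permutations with no fixed point). For a pair $(x,y)$, $\mathcal D_n[(x,y)]$ is the set of derangements $\pi$ with $\pi(x)=y$, and $d_{n,1}:=|\mathcal D_n[(x,y)]|$ for any $x\ne y$ (this does not depend on the choice of $x\neq y$). *)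

theory Defs
  imports "HOL-Combinatorics.Permutations" Complex_Main
begin

definition Sym :: "nat \<Rightarrow> (nat \<Rightarrow> nat) set" where
  "Sym n = {\<sigma>. \<sigma> permutes {1..n}}"

definition derangements :: "nat \<Rightarrow> (nat \<Rightarrow> nat) set" where
  "derangements n = {\<sigma>. \<sigma> permutes {1..n} \<and> (\<forall>i\<in>{1..n}. \<sigma> i \<noteq> i)}"

definition perm_intersect :: "nat \<Rightarrow> (nat \<Rightarrow> nat) \<Rightarrow> (nat \<Rightarrow> nat) \<Rightarrow> bool" where
  "perm_intersect n \<sigma> \<tau> \<longleftrightarrow> (\<exists>i\<in>{1..n}. \<sigma> i = \<tau> i)"

definition nu :: "nat \<Rightarrow> (nat \<Rightarrow> nat) set \<Rightarrow> nat" where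
  "nu n F = Max {card M | M. M \<subseteq> F \<and>
      (\<forall>\<sigma>\<in>M. \<forall>\<tau>\<in>M. \<sigma> \<noteq> \<tau> \<longrightarrow> \<not> perm_intersect n \<sigma> \<tau>)}"

definition derangements_at :: "nat \<Rightarrow> nat \<Rightarrow> nat \<Rightarrow> (nat \<Rightarrow> nat) set" where
  "derangements_at n x y = {\<pi> \<in> derangements n. \<pi> x = y}"

text \<open>d_{n,1} = |D_n[(x,y)]| for x \<noteq> y; we take (x,y) = (1,2).\<close>
definition d1 :: "nat \<Rightarrow> nat" where
  "d1 n = card (derangements_at n 1 2)"

end

theory Submission
  imports Defs "HOL-Library.FuncSet"
begin

text \<open>
  Permutations are viewed as \<open>n\<close>-element subsets of the grid. By the spread lemma, a random
  colouring of the grid shows that families that are \<open>r\<close>-spread with \<open>r\<close> of order \<open>s log n\<close>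
  contain pairwise disjoint representatives. Hence, if \<open>F\<close> is exhausted by removing
  spread subfamilies \<open>F[Y]\<close> one after the other, no \<open>s\<close> of their cores \<open>Y\<close> are pairwise disjoint.
  When a core of size \<open>j\<close> is removed, all degrees are at most \<open>16 * 100 ^ (1 - j) * d1 n\<close>, so the cores with
  at least two elements contribute little: unless there are exactly \<open>s - 1\<close> singleton cores, \<open>F\<close>
  is too small. If there are \<open>s - 1\<close> of them and \<open>F\<close> is large, then the corresponding stars are
  almost full, and a further permutation \<open>\<sigma>\<close> outside these stars would extend to \<open>s\<close> pairwise
  disjoint members of \<open>F\<close>, because a constant proportion of the derangements through a given pair
  avoid \<open>\<sigma>\<close>. So \<open>F\<close> is contained in the union of \<open>s - 1\<close> stars, and equality forces these to be full and
  disjoint, which means that their centres lie in one row or in one column.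
\<close>

section \<open>Rainbow matchings in spread families\<close>

text \<open>The logarithm in the bound on \<open>s\<close> is the price of a union bound: if each of
  at most \<open>s\<close> families owns \<open>b\<close> colours, a given one has no member in its
  own colours for a proportion of at most \<open>(3 / 5) ^ b * n\<close> of all colourings, so
  \<open>b\<close> has to be of order \<open>ln n\<close>; the value used is
  \<open>4 * ln n\<close>, rounded up. The permutations through a given pair are spread with
  parameter about \<open>n / 3\<close>. The requirement \<open>30000 * (s * b) \<le> n - 1\<close>
  leaves two spare factors of 100 there: one is built into the spreadness
  \<open>r = 100 * (s * b)\<close> of the cores, the other becomes the geometric decay of the
  degrees. As \<open>b\<close> is at most \<open>41 / 10 * ln n\<close> and
  \<open>30000 * 41 / 10 = 123000 < 2 ^ 17\<close>, this explains the constant in the theorem.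
  Derangements are awkward to count exactly. All degrees are therefore bounded through arbitrary
  permutations, and a switching argument supplies the only comparison needed,
  \<open>(n - 1)! \<le> 16 * d1 n\<close>. An exact result can come from such crude estimates
  because there is a gap: where a singleton core is missing, at most \<open>d1 n / 2\<close> members
  make up for it, while a full star has \<open>d1 n\<close>.\<close>

definition fragment :: "'a set set \<Rightarrow> ('a set \<Rightarrow> 'a set) \<Rightarrow> 'a set \<Rightarrow> 'a set \<Rightarrow> 'a set" where
  "fragment A T W S =
    T (ARG_MIN (\<lambda>S'. card (T S' - W)) S'. S' \<in> A \<and> T S' \<subseteq> T S \<union> W \<and> card (T S') \<le> card (T S)) - W"

text \<open>The fragment of \<open>S\<close> may stem from another member \<open>S'\<close>. The
  condition on \<open>T S'\<close> keeps the fragment inside \<open>T S\<close>. The condition on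
  cardinalities ensures, in the encoding below, that a fragment with more than half the size of
  \<open>T S\<close> also has more than half the size of the smallest set that can be found from the
  recoloured data.\<close>

lemma fragment_minimal:
  assumes "S \<in> A"
  obtains S' where "S' \<in> A" "T S' \<subseteq> T S \<union> W" "card (T S') \<le> card (T S)"
    "fragment A T W S = T S' - W"
    "\<And>S''. S'' \<in> A \<Longrightarrow> T S'' \<subseteq> T S \<union> W \<Longrightarrow> card (T S'') \<le> card (T S)
      \<Longrightarrow> card (T S' - W) \<le> card (T S'' - W)"
proof -
  let ?P = "\<lambda>S'. S' \<in> A \<and> T S' \<subseteq> T S \<union> W \<and> card (T S') \<le> card (T S)"
  let ?m = "\<lambda>S'. card (T S' - W)"
  have "?P S" using assms by auto
  then have "?P (arg_min ?m ?P)" by (rule arg_min_natI)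
  moreover have "?m (arg_min ?m ?P) \<le> ?m S''" if "?P S''" for S''
    using that by (rule arg_min_nat_le)
  ultimately show ?thesis using that[of "arg_min ?m ?P"] by (simp add: fragment_def)
qed

text \<open>The minimiser is a Hilbert choice over all sets, while \<open>T\<close> and
  \<open>T'\<close> agree on \<open>A\<close> only. Both problems have the same solutions, so the
  choice is the same one. This makes a fragment depend on the colouring only through the colours
  processed so far.\<close>

lemma fragment_cong:
  assumes "\<And>S. S \<in> A \<Longrightarrow> T S = T' S" "S \<in> A"
  shows "fragment A T W S = fragment A T' W S"
proof -
  let ?P = "\<lambda>T S'. S' \<in> A \<and> T S' \<subseteq> T S \<union> W \<and> card (T S') \<le> card (T S)"
  let ?m = "\<lambda>T S'. card (T S' - W)"
  have P: "?P T S' = ?P T' S'" for S'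
    using assms(1)[of S'] assms(1)[OF assms(2)] by (cases "S' \<in> A") simp_all
  then have P: "?P T = ?P T'" by (intro ext)
  have m: "?m T S' = ?m T' S'" if "?P T' S'" for S' using that assms(1)[of S'] by simp
  have "is_arg_min (?m T) (?P T) x = is_arg_min (?m T') (?P T') x" for x
    unfolding is_arg_min_def P using m by (metis (no_types, lifting))
  then have *: "arg_min (?m T) (?P T) = arg_min (?m T') (?P T')"
    unfolding arg_min_def by presburger
  have "?P T S" using assms by auto
  then have "?P T (arg_min (?m T) (?P T))" by (rule arg_min_natI)
  then have "T (arg_min (?m T) (?P T)) = T' (arg_min (?m T') (?P T'))"
    using assms(1) * by (metis (no_types, lifting))
  then show ?thesis unfolding fragment_def by simp
qed

text \<open>There are at most \<open>2 ^ card H \<le> 2 ^ (2 * h - 1)\<close> such \<open>Y\<close>,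
  and each has at least \<open>h\<close> elements. With \<open>card Y \<le> 2 ^ card Y\<close>
  everything is absorbed into \<open>(8 * \<rho>) ^ h / 2\<close>, a bound that does not grow with
  \<open>H\<close>.\<close>

lemma sum_heavy_subsets_le:
  fixes \<rho> :: real
  assumes "finite H" "H \<noteq> {}" "0 \<le> \<rho>" "8 * \<rho> \<le> 1"
  shows "(\<Sum>Y | Y \<subseteq> H \<and> card H < 2 * card Y. real (card Y) * \<rho> ^ card Y) \<le> 4 * \<rho>"
proof -
  define h where "h = card H div 2 + 1"
  have le: "real (card Y) * \<rho> ^ card Y \<le> (2 * \<rho>) ^ h" if "card H < 2 * card Y" for Y :: "'a set"
  proof -
    have "real (card Y) * \<rho> ^ card Y \<le> 2 ^ card Y * \<rho> ^ card Y"
      using assms(3) by (intro mult_right_mono) (auto simp: less_imp_le)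
    also have "\<dots> = (2 * \<rho>) ^ card Y" by (simp add: power_mult_distrib)
    also have "\<dots> \<le> (2 * \<rho>) ^ h"
      using assms that by (intro power_decreasing) (auto simp: h_def)
    finally show ?thesis .
  qed
  have "(\<Sum>Y | Y \<subseteq> H \<and> card H < 2 * card Y. real (card Y) * \<rho> ^ card Y)
      \<le> real (card {Y. Y \<subseteq> H \<and> card H < 2 * card Y}) * (2 * \<rho>) ^ h"
    by (rule sum_bounded_above) (use le in auto)
  also have "\<dots> \<le> 2 ^ card H * (2 * \<rho>) ^ h"
  proof (rule mult_right_mono)
    have "card {Y. Y \<subseteq> H \<and> card H < 2 * card Y} \<le> card (Pow H)"
      using assms(1) by (intro card_mono) auto
    then show "real (card {Y. Y \<subseteq> H \<and> card H < 2 * card Y}) \<le> 2 ^ card H"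
      using assms(1) by (simp add: card_Pow)
  qed (use assms in auto)
  also have "\<dots> \<le> 2 ^ (2 * h - 1) * (2 * \<rho>) ^ h"
    using assms by (intro mult_right_mono power_increasing) (auto simp: h_def)
  also have "\<dots> = (8 * \<rho>) ^ h / 2"
  proof -
    have "(2::real) ^ (2 * h - 1) * 2 = 2 ^ (2 * h)"
      by (simp add: h_def)
    also have "\<dots> = 4 ^ h" by (simp add: power_mult)
    finally have "(2::real) ^ (2 * h - 1) = 4 ^ h / 2" by simp
    moreover have "(4::real) ^ h * (2 * \<rho>) ^ h = (4 * (2 * \<rho>)) ^ h"
      by (rule power_mult_distrib[symmetric])
    ultimately have "2 ^ (2 * h - 1) * (2 * \<rho>) ^ h = (4 * (2 * \<rho>)) ^ h / 2"
      by (metis times_divide_eq_left)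
    then show ?thesis by simp
  qed
  also have "\<dots> \<le> 4 * \<rho>"
  proof -
    have "(8 * \<rho>) ^ h \<le> (8 * \<rho>) ^ 1"
      using assms by (intro power_decreasing) (auto simp: h_def)
    then show ?thesis by simp
  qed
  finally show ?thesis .
qed

text \<open>A pair of a colouring \<open>\<chi>\<close> and a set \<open>S\<close> whose new fragment \<open>Y\<close> has more than half the size
  of the old one is encoded by the colouring in which \<open>Y\<close> receives the colour \<open>c\<close>. By minimality \<open>Y\<close>
  lies in a smallest old fragment of colour \<open>c\<close>, which depends on the new colouring only; so few
  \<open>Y\<close> are possible, and spreadness bounds the number of \<open>S\<close> containing \<open>Y\<close>.\<close>

lemma spread_step:
  fixes X :: "'a set" and C :: "'c set" and A :: "'a set set"
    and T :: "('a \<Rightarrow> 'c) \<Rightarrow> 'a set \<Rightarrow> 'a set" and L \<rho> :: real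
  assumes finX: "finite X" and finC: "finite C" and AX: "A \<subseteq> Pow X"
    and spread: "\<And>Y. Y \<subseteq> X \<Longrightarrow> Y \<noteq> {} \<Longrightarrow>
        real (card {S\<in>A. Y \<subseteq> S}) * real (card C) ^ card Y \<le> L * real (card A) * \<rho> ^ card Y"
    and L: "0 \<le> L" and \<rho>: "0 \<le> \<rho>" "8 * \<rho> \<le> 1" "40 * L * \<rho> \<le> 1"
    and c: "c \<in> C" "c \<notin> U"
    and sub: "\<And>\<chi> S. \<chi> \<in> X \<rightarrow>\<^sub>E C \<Longrightarrow> S \<in> A \<Longrightarrow> T \<chi> S \<subseteq> S"
    and avoid: "\<And>\<chi> S x. \<chi> \<in> X \<rightarrow>\<^sub>E C \<Longrightarrow> S \<in> A \<Longrightarrow> x \<in> T \<chi> S \<Longrightarrow> \<chi> x \<notin> U"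
    and loc: "\<And>\<chi> \<chi>' S. \<chi> \<in> X \<rightarrow>\<^sub>E C \<Longrightarrow> \<chi>' \<in> X \<rightarrow>\<^sub>E C \<Longrightarrow>
        (\<And>x. x \<in> X \<Longrightarrow> \<chi> x \<noteq> \<chi>' x \<Longrightarrow> \<chi> x \<notin> U \<and> \<chi>' x \<notin> U) \<Longrightarrow> S \<in> A \<Longrightarrow> T \<chi> S = T \<chi>' S"
  shows "(\<Sum>\<chi>\<in>X \<rightarrow>\<^sub>E C. \<Sum>S\<in>A. real (card (fragment A (T \<chi>) {x\<in>X. \<chi> x = c} S)))
      \<le> 3 / 5 * (\<Sum>\<chi>\<in>X \<rightarrow>\<^sub>E C. \<Sum>S\<in>A. real (card (T \<chi> S)))"
proof -
  define \<Omega> where "\<Omega> = X \<rightarrow>\<^sub>E C"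
  define W where "W \<chi> = {x\<in>X. \<chi> x = c}" for \<chi> :: "'a \<Rightarrow> 'c"
  define T' where "T' \<chi> S = fragment A (T \<chi>) (W \<chi>) S" for \<chi> S
  define bad where "bad = {(\<chi>, S). \<chi> \<in> \<Omega> \<and> S \<in> A \<and> card (T \<chi> S) < 2 * card (T' \<chi> S)}"
  \<comment> \<open>With the default \<open>{}\<close> there are no candidates in
    \<open>Ys \<chi>\<close> when no old fragment lies in colour \<open>c\<close>.\<close>
  define best where "best \<chi> = (if \<exists>S\<in>A. T \<chi> S \<subseteq> W \<chi>
      then T \<chi> (ARG_MIN (\<lambda>S. card (T \<chi> S)) S. S \<in> A \<and> T \<chi> S \<subseteq> W \<chi>) else {})" for \<chi>
  define Ys where "Ys \<chi> = {Y. Y \<subseteq> best \<chi> \<and> card (best \<chi>) < 2 * card Y}" for \<chi>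
  define Q where "Q = (SIGMA \<chi>:\<Omega>. SIGMA Y:Ys \<chi>. {S\<in>A. Y \<subseteq> S} \<times> (Y \<rightarrow>\<^sub>E C))"
  \<comment> \<open>The last component records the colours overwritten on the fragment. It makes the
    encoding injective and costs the factor \<open>card C ^ card Y\<close> that is present in
    \<open>spread\<close>.\<close>
  define f where "f = (\<lambda>(\<chi>, S). (\<lambda>x. if x \<in> T' \<chi> S then c else \<chi> x, T' \<chi> S, S, restrict \<chi> (T' \<chi> S)))"
  have finA: "finite A" using AX finX by (meson finite_Pow_iff finite_subset)
  have fin\<Omega>: "finite \<Omega>" unfolding \<Omega>_def using finX finC by (intro finite_PiE) auto
  have finbad: "finite bad"
    by (rule finite_subset[of _ "\<Omega> \<times> A"]) (use finA fin\<Omega> in \<open>auto simp: bad_def\<close>)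
  have T'sub: "T' \<chi> S \<subseteq> T \<chi> S - W \<chi>" if S: "S \<in> A" for \<chi> S
  proof -
    obtain S' where "T \<chi> S' \<subseteq> T \<chi> S \<union> W \<chi>" "T' \<chi> S = T \<chi> S' - W \<chi>"
      using fragment_minimal[OF S, of "T \<chi>" "W \<chi>"] unfolding T'_def by metis
    then show ?thesis by auto
  qed
  have bestprop: "best \<chi> \<subseteq> W \<chi> \<and> (\<exists>S\<in>A. best \<chi> = T \<chi> S) \<and> card (best \<chi>) \<le> card (T \<chi> S)"
    if "S \<in> A" "T \<chi> S \<subseteq> W \<chi>" for \<chi> S
  proof -
    let ?P = "\<lambda>S. S \<in> A \<and> T \<chi> S \<subseteq> W \<chi>"
    have "?P S" using that by auto
    then have "?P (arg_min (\<lambda>S. card (T \<chi> S)) ?P)"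
      "card (T \<chi> (arg_min (\<lambda>S. card (T \<chi> S)) ?P)) \<le> card (T \<chi> S)"
      by (rule arg_min_natI, rule arg_min_nat_le)
    moreover have "best \<chi> = T \<chi> (arg_min (\<lambda>S. card (T \<chi> S)) ?P)"
      using that by (auto simp: best_def)
    ultimately show ?thesis by auto
  qed
  have TX: "T \<chi> S \<subseteq> X" if "\<chi> \<in> \<Omega>" "S \<in> A" for \<chi> S
    using sub[of \<chi> S] that AX unfolding \<Omega>_def by blast
  have best_X: "best \<chi> \<subseteq> X" for \<chi>
  proof (cases "\<exists>S\<in>A. T \<chi> S \<subseteq> W \<chi>")
    case True
    then show ?thesis using bestprop[of _ \<chi>] unfolding W_def by blast
  qed (simp add: best_def)
  have finYs: "finite (Ys \<chi>)" for \<chi>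
    by (rule finite_subset[of _ "Pow X"]) (use best_X finX in \<open>auto simp: Ys_def\<close>)
  have YsX: "Y \<subseteq> X \<and> Y \<noteq> {}" if "Y \<in> Ys \<chi>" for Y \<chi>
    using that best_X unfolding Ys_def by fastforce
  have finQ: "finite Q"
    unfolding Q_def
  proof (intro finite_SigmaI)
    fix \<chi> Y assume "Y \<in> Ys \<chi>"
    then have "finite Y" using YsX finX finite_subset by blast
    then show "finite (Y \<rightarrow>\<^sub>E C)" using finC by (intro finite_PiE) auto
  qed (use fin\<Omega> finYs finA in auto)
  have fQ: "f p \<in> Q" if "p \<in> bad" for p
  proof -
    obtain \<chi> S where p: "p = (\<chi>, S)" by force
    have \<chi>: "\<chi> \<in> \<Omega>" and S: "S \<in> A" and lt: "card (T \<chi> S) < 2 * card (T' \<chi> S)"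
      using that p by (auto simp: bad_def)
    define Y where "Y = T' \<chi> S"
    define \<chi>' where "\<chi>' = (\<lambda>x. if x \<in> Y then c else \<chi> x)"
    have YT: "Y \<subseteq> T \<chi> S - W \<chi>" using T'sub[OF S] Y_def by auto
    have YX: "Y \<subseteq> X" using YT TX[OF \<chi> S] by auto
    have \<chi>': "\<chi>' \<in> \<Omega>" using \<chi> YX c unfolding \<Omega>_def \<chi>'_def by (auto simp: PiE_iff extensional_def)
    \<comment> \<open>The recolouring is invisible to \<open>T\<close>: by \<open>avoid\<close> the
      old colours on \<open>Y\<close> are outside \<open>U\<close>, and so is
      \<open>c\<close>.\<close>
    have same: "T \<chi>' S' = T \<chi> S'" if "S' \<in> A" for S'
    proof (rule loc[OF _ _ _ that])
      fix x assume "x \<in> X" "\<chi>' x \<noteq> \<chi> x"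
      then have "x \<in> Y" "\<chi>' x = c" by (auto simp: \<chi>'_def split: if_splits)
      then show "\<chi>' x \<notin> U \<and> \<chi> x \<notin> U" using avoid[of \<chi> S x] \<chi> S YT c unfolding \<Omega>_def by auto
    qed (use \<chi> \<chi>' in \<open>auto simp: \<Omega>_def\<close>)
    have W': "W \<chi>' = W \<chi> \<union> Y" using YX by (auto simp: W_def \<chi>'_def)
    obtain S' where S': "S' \<in> A" "T \<chi> S' \<subseteq> T \<chi> S \<union> W \<chi>" "card (T \<chi> S') \<le> card (T \<chi> S)"
      "Y = T \<chi> S' - W \<chi>"
      "\<And>S''. S'' \<in> A \<Longrightarrow> T \<chi> S'' \<subseteq> T \<chi> S \<union> W \<chi> \<Longrightarrow> card (T \<chi> S'') \<le> card (T \<chi> S)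
      \<Longrightarrow> card (T \<chi> S' - W \<chi>) \<le> card (T \<chi> S'' - W \<chi>)"
      using fragment_minimal[OF S, of "T \<chi>" "W \<chi>"] unfolding Y_def T'_def by metis
    have "T \<chi>' S' \<subseteq> W \<chi>'" using same[OF S'(1)] W' S'(4) by auto
    note bp = bestprop[OF S'(1) this]
    obtain S0 where S0: "S0 \<in> A" "best \<chi>' = T \<chi> S0" using bp same by metis
    have S0sub: "T \<chi> S0 \<subseteq> W \<chi> \<union> Y" using bp S0 W' by auto
    have cardS0: "card (T \<chi> S0) \<le> card (T \<chi> S)" using bp S0 S'(3) same[OF S'(1)] by simp
    \<comment> \<open>\<open>S0\<close> competes in the minimisation that produced \<open>Y\<close>,
      so its part outside \<open>W \<chi>\<close> has at least \<open>card Y\<close> elements. This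
      part is contained in \<open>Y\<close>, hence equal to it, and \<open>Y\<close> lies in
      \<open>best \<chi>'\<close>.\<close>
    have "T \<chi> S0 \<subseteq> T \<chi> S \<union> W \<chi>" using S0sub YT by auto
    then have "card Y \<le> card (T \<chi> S0 - W \<chi>)" using S'(4,5) S0(1) cardS0 by simp
    moreover have "T \<chi> S0 - W \<chi> \<subseteq> Y" using S0sub by auto
    moreover have "finite Y" using YX finX finite_subset by blast
    ultimately have "T \<chi> S0 - W \<chi> = Y" by (metis card_seteq)
    then have "Y \<in> Ys \<chi>'" unfolding Ys_def using S0 cardS0 lt Y_def by auto
    moreover have "Y \<subseteq> S" using YT sub[of \<chi> S] \<chi> S unfolding \<Omega>_def by auto
    moreover have "restrict \<chi> Y \<in> Y \<rightarrow>\<^sub>E C" using \<chi> YX unfolding \<Omega>_def by auto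
    ultimately show ?thesis
      using \<chi>' S unfolding f_def p Q_def by (simp add: \<chi>'_def Y_def)
  qed
  have inj: "inj_on f bad"
  proof (rule inj_onI)
    fix p q assume "p \<in> bad" "q \<in> bad" and eq: "f p = f q"
    obtain \<chi> S \<chi>' S' where pq: "p = (\<chi>, S)" "q = (\<chi>', S')" by (metis surj_pair)
    have fe: "f (\<chi>, S) = f (\<chi>', S')" using eq pq by simp
    have SS: "S' = S" using fe by (simp add: f_def)
    have YY: "T' \<chi>' S = T' \<chi> S" using fe SS by (simp add: f_def)
    have e1: "(if x \<in> T' \<chi> S then c else \<chi> x) = (if x \<in> T' \<chi> S then c else \<chi>' x)" for x :: 'a
      using fun_cong[OF arg_cong[where f = fst, OF fe], of x] SS YY by (simp add: f_def)
    have e2: "restrict \<chi> (T' \<chi> S) = restrict \<chi>' (T' \<chi> S)"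
      using fe SS YY by (simp add: f_def)
    have "\<chi> x = \<chi>' x" for x
      using e1[of x] fun_cong[OF e2, of x] by (cases "x \<in> T' \<chi> S") auto
    then show "p = q" using pq SS by auto
  qed
  have inner: "(\<Sum>Y\<in>Ys \<chi>. real (card Y) * (real (card {S\<in>A. Y \<subseteq> S}) * real (card C) ^ card Y))
      \<le> 1 / 10 * (\<Sum>S\<in>A. real (card (T \<chi> S)))" if \<chi>: "\<chi> \<in> \<Omega>" for \<chi>
  proof (cases "best \<chi> = {}")
    case True
    then have "Ys \<chi> = {}" by (auto simp: Ys_def)
    then show ?thesis by (simp add: sum_nonneg)
  next
    case False
    \<comment> \<open>An empty old fragment would be a smallest one of colour \<open>c\<close> and
      make \<open>best \<chi>\<close> empty. So the old fragments have total size at least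
      \<open>card A\<close>, the quantity in which spreadness is measured.\<close>
    have ne: "1 \<le> card (T \<chi> S)" if "S \<in> A" for S
    proof (rule ccontr)
      assume "\<not> 1 \<le> card (T \<chi> S)"
      moreover have "finite (T \<chi> S)" using TX[OF \<chi> that] finX finite_subset by blast
      ultimately have "T \<chi> S = {}" by (metis One_nat_def Suc_leI card_gt_0_iff)
      then have "card (best \<chi>) = 0" using bestprop[OF that, of \<chi>] by simp
      moreover have "finite (best \<chi>)" using best_X finX finite_subset by blast
      ultimately show False using False by simp
    qed
    have "(\<Sum>Y\<in>Ys \<chi>. real (card Y) * (real (card {S\<in>A. Y \<subseteq> S}) * real (card C) ^ card Y))
       \<le> (\<Sum>Y\<in>Ys \<chi>. L * real (card A) * (real (card Y) * \<rho> ^ card Y))"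
    proof (rule sum_mono)
      fix Y assume "Y \<in> Ys \<chi>"
      then have "real (card {S\<in>A. Y \<subseteq> S}) * real (card C) ^ card Y \<le> L * real (card A) * \<rho> ^ card Y"
        using spread YsX by blast
      from mult_left_mono[OF this, of "real (card Y)"]
      show "real (card Y) * (real (card {S\<in>A. Y \<subseteq> S}) * real (card C) ^ card Y)
          \<le> L * real (card A) * (real (card Y) * \<rho> ^ card Y)"
        by (simp add: mult.commute mult.left_commute)
    qed
    also have "\<dots> = L * real (card A) * (\<Sum>Y\<in>Ys \<chi>. real (card Y) * \<rho> ^ card Y)"
      by (simp add: sum_distrib_left)
    also have "\<dots> \<le> L * real (card A) * (4 * \<rho>)"
    proof (rule mult_left_mono)
      show "(\<Sum>Y\<in>Ys \<chi>. real (card Y) * \<rho> ^ card Y) \<le> 4 * \<rho>"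
        unfolding Ys_def using best_X finX False \<rho>
        by (intro sum_heavy_subsets_le finite_subset[OF best_X finX]) auto
    qed (use L in auto)
    also have "\<dots> = (40 * L * \<rho>) * (real (card A) / 10)" by simp
    also have "\<dots> \<le> 1 * (real (card A) / 10)"
      using \<rho> by (intro mult_right_mono) auto
    also have "real (card A) \<le> (\<Sum>S\<in>A. real (card (T \<chi> S)))"
    proof -
      have "(\<Sum>S\<in>A. 1::real) \<le> (\<Sum>S\<in>A. real (card (T \<chi> S)))"
        by (rule sum_mono) (use ne in force)
      then show ?thesis by simp
    qed
    finally show ?thesis by simp
  qed
  have "(\<Sum>(\<chi>, S)\<in>bad. real (card (T' \<chi> S))) = (\<Sum>p\<in>bad. real (card (fst (snd (f p)))))"
    by (rule sum.cong) (auto simp: f_def)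
  also have "\<dots> = (\<Sum>q\<in>f ` bad. real (card (fst (snd q))))"
    by (subst sum.reindex[OF inj]) simp
  also have "\<dots> \<le> (\<Sum>q\<in>Q. real (card (fst (snd q))))"
    by (rule sum_mono2[OF finQ]) (use fQ in auto)
  also have "\<dots> = (\<Sum>\<chi>\<in>\<Omega>. \<Sum>Y\<in>Ys \<chi>. \<Sum>z\<in>{S\<in>A. Y \<subseteq> S} \<times> (Y \<rightarrow>\<^sub>E C). real (card Y))"
  proof -
    have fz: "finite ({S\<in>A. Y \<subseteq> S} \<times> (Y \<rightarrow>\<^sub>E C))" if "Y \<in> Ys \<chi>" for Y \<chi>
    proof -
      have "finite Y" using YsX[OF that] finX finite_subset by blast
      then show ?thesis using finC finA by (intro finite_cartesian_product finite_PiE) auto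
    qed
    have "(\<Sum>\<chi>\<in>\<Omega>. \<Sum>Y\<in>Ys \<chi>. \<Sum>z\<in>{S\<in>A. Y \<subseteq> S} \<times> (Y \<rightarrow>\<^sub>E C). real (card Y))
      = (\<Sum>\<chi>\<in>\<Omega>. \<Sum>(Y,z)\<in>(SIGMA Y:Ys \<chi>. {S\<in>A. Y \<subseteq> S} \<times> (Y \<rightarrow>\<^sub>E C)). real (card Y))"
      by (intro sum.cong refl sum.Sigma finYs ballI fz)
    also have "\<dots> = (\<Sum>(\<chi>,Yz)\<in>Q. real (card (fst Yz)))"
      unfolding Q_def
      by (subst sum.Sigma[symmetric])
         (auto intro!: fin\<Omega> finYs fz sum.cong simp: split_beta)
    finally show ?thesis by (simp add: split_beta)
  qed
  also have "\<dots> = (\<Sum>\<chi>\<in>\<Omega>. \<Sum>Y\<in>Ys \<chi>. real (card Y) * (real (card {S\<in>A. Y \<subseteq> S}) * real (card C) ^ card Y))"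
  proof (intro sum.cong refl)
    fix \<chi> Y assume "Y \<in> Ys \<chi>"
    then have "finite Y" using YsX finX finite_subset by blast
    then show "(\<Sum>z\<in>{S\<in>A. Y \<subseteq> S} \<times> (Y \<rightarrow>\<^sub>E C). real (card Y))
       = real (card Y) * (real (card {S\<in>A. Y \<subseteq> S}) * real (card C) ^ card Y)"
      by (simp add: card_cartesian_product card_PiE)
  qed
  also have "\<dots> \<le> (\<Sum>\<chi>\<in>\<Omega>. 1 / 10 * (\<Sum>S\<in>A. real (card (T \<chi> S))))"
    by (intro sum_mono inner)
  finally have badsum: "(\<Sum>(\<chi>, S)\<in>bad. real (card (T' \<chi> S)))
      \<le> 1 / 10 * (\<Sum>\<chi>\<in>\<Omega>. \<Sum>S\<in>A. real (card (T \<chi> S)))"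
    by (simp add: sum_distrib_left)
  \<comment> \<open>Pairs outside \<open>bad\<close> at least halve their fragment, and the bad ones
    contribute at most a tenth of the old total: \<open>1 / 2 + 1 / 10 = 3 / 5\<close>.\<close>
  have "(\<Sum>\<chi>\<in>\<Omega>. \<Sum>S\<in>A. real (card (T' \<chi> S)))
    \<le> (\<Sum>\<chi>\<in>\<Omega>. \<Sum>S\<in>A. 1 / 2 * real (card (T \<chi> S)) + (if (\<chi>, S) \<in> bad then real (card (T' \<chi> S)) else 0))"
    by (intro sum_mono) (auto simp: bad_def)
  also have "\<dots> = 1 / 2 * (\<Sum>\<chi>\<in>\<Omega>. \<Sum>S\<in>A. real (card (T \<chi> S)))
      + (\<Sum>\<chi>\<in>\<Omega>. \<Sum>S\<in>A. if (\<chi>, S) \<in> bad then real (card (T' \<chi> S)) else 0)"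
    by (simp add: sum.distrib sum_distrib_left)
  also have "(\<Sum>\<chi>\<in>\<Omega>. \<Sum>S\<in>A. if (\<chi>, S) \<in> bad then real (card (T' \<chi> S)) else 0)
      = (\<Sum>(\<chi>, S)\<in>bad. real (card (T' \<chi> S)))"
  proof -
    have "(\<Sum>\<chi>\<in>\<Omega>. \<Sum>S\<in>A. if (\<chi>, S) \<in> bad then real (card (T' \<chi> S)) else 0)
      = (\<Sum>p\<in>\<Omega> \<times> A. if p \<in> bad then real (card (T' (fst p) (snd p))) else 0)"
      by (subst sum.cartesian_product) (auto intro!: sum.cong)
    also have "\<dots> = (\<Sum>p\<in>(\<Omega> \<times> A) \<inter> bad. real (card (T' (fst p) (snd p))))"
      using fin\<Omega> finA by (subst sum.inter_restrict) auto
    also have "(\<Omega> \<times> A) \<inter> bad = bad" by (auto simp: bad_def)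
    finally show ?thesis by (simp add: split_beta)
  qed
  finally show ?thesis using badsum unfolding T'_def W_def \<Omega>_def by simp
qed

text \<open>The colours of \<open>U\<close> are processed one at a time, each shrinking the total
  size of the fragments by the factor \<open>3 / 5\<close>. If a colouring admits no member coloured
  within \<open>U\<close>, all its fragments are still nonempty, so the total size bounds the number
  of such colourings, as in Markov's inequality.\<close>

theorem spread_colouring:
  fixes X :: "'a set" and C :: "'c set" and A :: "'a set set" and L \<rho> :: real
  assumes finX: "finite X" and finC: "finite C" and AX: "A \<subseteq> Pow X"
    and spread: "\<And>Y. Y \<subseteq> X \<Longrightarrow> Y \<noteq> {} \<Longrightarrow>
        real (card {S\<in>A. Y \<subseteq> S}) * real (card C) ^ card Y \<le> L * real (card A) * \<rho> ^ card Y"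
    and L: "0 \<le> L" and \<rho>: "0 \<le> \<rho>" "8 * \<rho> \<le> 1" "40 * L * \<rho> \<le> 1"
    and A: "A \<noteq> {}" "\<And>S. S \<in> A \<Longrightarrow> card S \<le> k" and U: "U \<subseteq> C"
  shows "real (card {\<chi> \<in> X \<rightarrow>\<^sub>E C. \<forall>S\<in>A. \<not> \<chi> ` S \<subseteq> U}) \<le> (3 / 5) ^ card U * real k * real (card C) ^ card X"
proof -
  define \<Omega> where "\<Omega> = X \<rightarrow>\<^sub>E C"
  have finA: "finite A" using AX finX by (meson finite_Pow_iff finite_subset)
  have fin\<Omega>: "finite \<Omega>" unfolding \<Omega>_def using finX finC by (intro finite_PiE) auto
  \<comment> \<open>The clauses say that the fragment \<open>T \<chi> S\<close> lies in
    \<open>S\<close>, contains no colour of \<open>U\<close>, depends only on where the colours of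
    \<open>U\<close> occur, covers some member of \<open>A\<close> together with the points coloured
    from \<open>U\<close>, and is small on average.\<close>
  define inv where "inv U T \<longleftrightarrow> (\<forall>\<chi>\<in>\<Omega>. \<forall>S\<in>A. T \<chi> S \<subseteq> S) \<and> (\<forall>\<chi>\<in>\<Omega>. \<forall>S\<in>A. \<forall>x\<in>T \<chi> S. \<chi> x \<notin> U)
      \<and> (\<forall>\<chi>\<in>\<Omega>. \<forall>\<chi>'\<in>\<Omega>. (\<forall>x\<in>X. \<chi> x \<noteq> \<chi>' x \<longrightarrow> \<chi> x \<notin> U \<and> \<chi>' x \<notin> U) \<longrightarrow> (\<forall>S\<in>A. T \<chi> S = T \<chi>' S))
      \<and> (\<forall>\<chi>\<in>\<Omega>. \<forall>S\<in>A. \<exists>S'\<in>A. \<forall>x\<in>S'. x \<in> T \<chi> S \<or> \<chi> x \<in> U)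
      \<and> (\<Sum>\<chi>\<in>\<Omega>. \<Sum>S\<in>A. real (card (T \<chi> S))) \<le> (3 / 5) ^ card U * (real (card \<Omega>) * (real (card A) * real k))" for U :: "'c set" and T :: "('a \<Rightarrow> 'c) \<Rightarrow> 'a set \<Rightarrow> 'a set"
  have "finite U" using U finC finite_subset by blast
  then have "\<exists>T. inv U T"
    using U
  proof (induction U rule: finite_induct)
    case empty
    have "(\<Sum>\<chi>\<in>\<Omega>. \<Sum>S\<in>A. real (card S)) \<le> (\<Sum>\<chi>\<in>\<Omega>. \<Sum>S\<in>A. real k)"
      by (intro sum_mono) (use A in auto)
    then show ?case
      by (intro exI[of _ "\<lambda>_ S. S"]) (auto simp: mult.assoc inv_def)
  next
    case (insert c U)
    then obtain T where T: "inv U T" by auto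
    have sub: "T \<chi> S \<subseteq> S" if "\<chi> \<in> \<Omega>" "S \<in> A" for \<chi> S
      using T that unfolding inv_def by blast
    have avoid: "\<chi> x \<notin> U" if "\<chi> \<in> \<Omega>" "S \<in> A" "x \<in> T \<chi> S" for \<chi> S x
      using T that unfolding inv_def by blast
    have loc: "T \<chi> S = T \<chi>' S" if "\<chi> \<in> \<Omega>" "\<chi>' \<in> \<Omega>"
      "\<And>x. x \<in> X \<Longrightarrow> \<chi> x \<noteq> \<chi>' x \<Longrightarrow> \<chi> x \<notin> U \<and> \<chi>' x \<notin> U" "S \<in> A" for \<chi> \<chi>' S
      using T that unfolding inv_def by blast
    have cov: "\<exists>S'\<in>A. \<forall>x\<in>S'. x \<in> T \<chi> S \<or> \<chi> x \<in> U" if "\<chi> \<in> \<Omega>" "S \<in> A" for \<chi> S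
      using T that unfolding inv_def by blast
    have bound: "(\<Sum>\<chi>\<in>\<Omega>. \<Sum>S\<in>A. real (card (T \<chi> S)))
          \<le> (3 / 5) ^ card U * (real (card \<Omega>) * (real (card A) * real k))"
      using T unfolding inv_def by blast
    define W where "W \<chi> = {x\<in>X. \<chi> x = c}" for \<chi> :: "'a \<Rightarrow> 'c"
    define T' where "T' \<chi> S = fragment A (T \<chi>) (W \<chi>) S" for \<chi> S
    have frag: "\<exists>S'\<in>A. T \<chi> S' \<subseteq> T \<chi> S \<union> W \<chi> \<and> T' \<chi> S = T \<chi> S' - W \<chi>" if "S \<in> A" for \<chi> S
      using fragment_minimal[OF that, of "T \<chi>" "W \<chi>"] unfolding T'_def by metis
    then have T'sub: "T' \<chi> S \<subseteq> T \<chi> S - W \<chi>" if "S \<in> A" for \<chi> S using that by blast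
    have "(\<Sum>\<chi>\<in>\<Omega>. \<Sum>S\<in>A. real (card (T' \<chi> S))) \<le> 3 / 5 * (\<Sum>\<chi>\<in>\<Omega>. \<Sum>S\<in>A. real (card (T \<chi> S)))"
      unfolding T'_def W_def \<Omega>_def
    proof (rule spread_step[OF finX finC AX spread L \<rho>, of c U])
      show "T \<chi> S = T \<chi>' S" if "\<chi> \<in> X \<rightarrow>\<^sub>E C" "\<chi>' \<in> X \<rightarrow>\<^sub>E C"
        "\<And>x. x \<in> X \<Longrightarrow> \<chi> x \<noteq> \<chi>' x \<Longrightarrow> \<chi> x \<notin> U \<and> \<chi>' x \<notin> U" "S \<in> A" for \<chi> \<chi>' S
        using loc[OF _ _ _ that(4)] that(1-3) unfolding \<Omega>_def by blast
    qed (use sub avoid insert in \<open>auto simp: \<Omega>_def\<close>)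
    also have "\<dots> \<le> 3 / 5 * ((3 / 5) ^ card U * (real (card \<Omega>) * (real (card A) * real k)))"
      using bound by (intro mult_left_mono) auto
    also have "\<dots> = (3 / 5) ^ card (insert c U) * (real (card \<Omega>) * (real (card A) * real k))"
      using insert by simp
    finally have bound': "(\<Sum>\<chi>\<in>\<Omega>. \<Sum>S\<in>A. real (card (T' \<chi> S)))
      \<le> (3 / 5) ^ card (insert c U) * (real (card \<Omega>) * (real (card A) * real k))" .
    have sub': "T' \<chi> S \<subseteq> S" if "\<chi> \<in> \<Omega>" "S \<in> A" for \<chi> S
      using T'sub sub that by blast
    have avoid': "\<chi> x \<notin> insert c U" if "\<chi> \<in> \<Omega>" "S \<in> A" "x \<in> T' \<chi> S" for \<chi> S x
    proof -
      have "x \<in> T \<chi> S" "x \<notin> W \<chi>" using T'sub that by blast+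
      moreover have "x \<in> X" using sub AX that calculation by blast
      ultimately show ?thesis using avoid[of \<chi> S x] that unfolding W_def by auto
    qed
    have loc': "T' \<chi> S = T' \<chi>' S" if "\<chi> \<in> \<Omega>" "\<chi>' \<in> \<Omega>"
        "\<forall>x\<in>X. \<chi> x \<noteq> \<chi>' x \<longrightarrow> \<chi> x \<notin> insert c U \<and> \<chi>' x \<notin> insert c U" "S \<in> A" for \<chi> \<chi>' S
    proof -
      have "W \<chi> = W \<chi>'" unfolding W_def using that(3) by (auto; metis insertI1)
      moreover have "T \<chi> S' = T \<chi>' S'" if "S' \<in> A" for S'
        by (rule loc) (use that \<open>\<chi> \<in> \<Omega>\<close> \<open>\<chi>' \<in> \<Omega>\<close>
          \<open>\<forall>x\<in>X. \<chi> x \<noteq> \<chi>' x \<longrightarrow> \<chi> x \<notin> insert c U \<and> \<chi>' x \<notin> insert c U\<close> in auto)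
      ultimately show ?thesis unfolding T'_def using fragment_cong[OF _ that(4)] by metis
    qed
    have cov': "\<exists>S'\<in>A. \<forall>x\<in>S'. x \<in> T' \<chi> S \<or> \<chi> x \<in> insert c U" if \<chi>: "\<chi> \<in> \<Omega>" and S: "S \<in> A" for \<chi> S
    proof -
      obtain S1 where S1: "S1 \<in> A" "T' \<chi> S = T \<chi> S1 - W \<chi>" using frag[OF S] by blast
      obtain S2 where "S2 \<in> A" "\<forall>x\<in>S2. x \<in> T \<chi> S1 \<or> \<chi> x \<in> U" using cov[OF \<chi> S1(1)] by blast
      then show ?thesis using S1 unfolding W_def by auto
    qed
    show ?case
    proof (rule exI[of _ T'], unfold inv_def, intro conjI)
      show "\<forall>\<chi>\<in>\<Omega>. \<forall>S\<in>A. T' \<chi> S \<subseteq> S" using sub' by simp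
      show "\<forall>\<chi>\<in>\<Omega>. \<forall>S\<in>A. \<forall>x\<in>T' \<chi> S. \<chi> x \<notin> insert c U" using avoid' by (intro ballI)
      show "\<forall>\<chi>\<in>\<Omega>. \<forall>\<chi>'\<in>\<Omega>. (\<forall>x\<in>X. \<chi> x \<noteq> \<chi>' x \<longrightarrow> \<chi> x \<notin> insert c U \<and> \<chi>' x \<notin> insert c U)
          \<longrightarrow> (\<forall>S\<in>A. T' \<chi> S = T' \<chi>' S)"
        by (intro ballI impI) (rule loc')
      show "\<forall>\<chi>\<in>\<Omega>. \<forall>S\<in>A. \<exists>S'\<in>A. \<forall>x\<in>S'. x \<in> T' \<chi> S \<or> \<chi> x \<in> insert c U"
        by (intro ballI cov')
    qed (rule bound')
  qed
  then obtain T where T: "inv U T" by blast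
  have cov: "\<exists>S'\<in>A. \<forall>x\<in>S'. x \<in> T \<chi> S \<or> \<chi> x \<in> U" if "\<chi> \<in> \<Omega>" "S \<in> A" for \<chi> S
    using T that unfolding inv_def by blast
  have sub: "T \<chi> S \<subseteq> S" if "\<chi> \<in> \<Omega>" "S \<in> A" for \<chi> S
    using T that unfolding inv_def by blast
  have bound: "(\<Sum>\<chi>\<in>\<Omega>. \<Sum>S\<in>A. real (card (T \<chi> S)))
        \<le> (3 / 5) ^ card U * (real (card \<Omega>) * (real (card A) * real k))"
    using T unfolding inv_def by blast
  define B where "B = {\<chi> \<in> \<Omega>. \<forall>S\<in>A. \<not> \<chi> ` S \<subseteq> U}"
  have one: "1 \<le> card (T \<chi> S)" if "\<chi> \<in> B" "S \<in> A" for \<chi> S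
  proof -
    have "T \<chi> S \<noteq> {}" using cov[of \<chi> S] that unfolding B_def by blast
    moreover have "T \<chi> S \<subseteq> X" using sub[of \<chi> S] that AX unfolding B_def by auto
    then have "finite (T \<chi> S)" using finX finite_subset by blast
    ultimately show ?thesis by (metis One_nat_def Suc_leI card_gt_0_iff)
  qed
  have "real (card B) * real (card A) = (\<Sum>\<chi>\<in>B. \<Sum>S\<in>A. 1::real)" by simp
  also have "\<dots> \<le> (\<Sum>\<chi>\<in>B. \<Sum>S\<in>A. real (card (T \<chi> S)))"
    by (intro sum_mono) (use one in force)
  also have "\<dots> \<le> (\<Sum>\<chi>\<in>\<Omega>. \<Sum>S\<in>A. real (card (T \<chi> S)))"
    using fin\<Omega> by (intro sum_mono2) (auto simp: B_def sum_nonneg)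
  also note bound
  finally have "real (card B) * real (card A) \<le> ((3 / 5) ^ card U * real k * real (card \<Omega>)) * real (card A)"
    by (simp add: mult_ac)
  moreover have "0 < real (card A)" using A finA by (simp add: card_gt_0_iff)
  ultimately have "real (card B) \<le> (3 / 5) ^ card U * real k * real (card \<Omega>)" by simp
  then show ?thesis unfolding B_def \<Omega>_def using finX by (simp add: card_PiE)
qed

text \<open>Each index owns \<open>b\<close> of the \<open>card I * b\<close> colours. By the union
  bound, some colouring gives every family a member that uses only the colours of its own index.
  These members are disjoint because a point has only one colour.\<close>

corollary rainbow_disjoint_sets:
  fixes X :: "'a set" and A :: "'i \<Rightarrow> 'a set set" and L \<rho> :: real
  assumes finX: "finite X" and finI: "finite I" and AX: "\<And>i. i \<in> I \<Longrightarrow> A i \<subseteq> Pow X"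
    and spread: "\<And>i Y. i \<in> I \<Longrightarrow> Y \<subseteq> X \<Longrightarrow> Y \<noteq> {} \<Longrightarrow>
        real (card {S\<in>A i. Y \<subseteq> S}) * (real (card I) * real b) ^ card Y \<le> L * real (card (A i)) * \<rho> ^ card Y"
    and L: "0 \<le> L" and \<rho>: "0 \<le> \<rho>" "8 * \<rho> \<le> 1" "40 * L * \<rho> \<le> 1"
    and A: "\<And>i. i \<in> I \<Longrightarrow> A i \<noteq> {}" "\<And>i S. i \<in> I \<Longrightarrow> S \<in> A i \<Longrightarrow> card S \<le> k"
    and small: "real (card I) * ((3 / 5) ^ b * real k) < 1" and b: "0 < b"
  shows "\<exists>R. (\<forall>i\<in>I. R i \<in> A i) \<and> (\<forall>i\<in>I. \<forall>j\<in>I. i \<noteq> j \<longrightarrow> R i \<inter> R j = {})"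
proof (cases "I = {}")
  case False
  define C where "C = I \<times> {..<b}"
  define \<Omega> where "\<Omega> = X \<rightarrow>\<^sub>E C"
  define B where "B i = {\<chi> \<in> \<Omega>. \<forall>S\<in>A i. \<not> \<chi> ` S \<subseteq> {i} \<times> {..<b}}" for i
  have cC: "real (card C) = real (card I) * real b" by (simp add: C_def card_cartesian_product)
  have finC: "finite C" using finI by (simp add: C_def)
  have fin\<Omega>: "finite \<Omega>" unfolding \<Omega>_def using finX finC by (intro finite_PiE) auto
  have c\<Omega>: "real (card \<Omega>) = real (card C) ^ card X" unfolding \<Omega>_def using finX by (simp add: card_PiE)
  have "C \<noteq> {}" using False b by (auto simp: C_def)
  then have pos: "0 < real (card \<Omega>)" unfolding c\<Omega> using finC by (simp add: card_gt_0_iff)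
  have Bi: "real (card (B i)) \<le> (3 / 5) ^ b * real k * real (card \<Omega>)" if i: "i \<in> I" for i
  proof -
    have "real (card (B i)) \<le> (3 / 5) ^ card ({i} \<times> {..<b}) * real k * real (card C) ^ card X"
      unfolding B_def \<Omega>_def
    proof (rule spread_colouring[OF finX finC AX[OF i] _ L \<rho> A(1)[OF i] A(2)[OF i]])
      show "real (card {S\<in>A i. Y \<subseteq> S}) * real (card C) ^ card Y \<le> L * real (card (A i)) * \<rho> ^ card Y"
        if "Y \<subseteq> X" "Y \<noteq> {}" for Y using spread[OF i that] cC by simp
    qed (use i in \<open>auto simp: C_def\<close>)
    then show ?thesis by (simp add: c\<Omega> card_cartesian_product)
  qed
  have "real (card (\<Union>i\<in>I. B i)) \<le> (\<Sum>i\<in>I. real (card (B i)))"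
    using card_UN_le[OF finI, of B] by (metis of_nat_mono of_nat_sum)
  also have "\<dots> \<le> real (card I) * ((3 / 5) ^ b * real k * real (card \<Omega>))"
    by (rule sum_bounded_above) (use Bi in auto)
  also have "\<dots> = (real (card I) * ((3 / 5) ^ b * real k)) * real (card \<Omega>)" by simp
  also have "\<dots> < 1 * real (card \<Omega>)" using small pos by (intro mult_strict_right_mono) auto
  finally have "card (\<Union>i\<in>I. B i) < card \<Omega>" by simp
  moreover have "(\<Union>i\<in>I. B i) \<subseteq> \<Omega>" by (auto simp: B_def)
  ultimately obtain \<chi> where \<chi>: "\<chi> \<in> \<Omega>" "\<chi> \<notin> (\<Union>i\<in>I. B i)"
    by (metis less_irrefl subsetI subset_antisym)
  then have "\<forall>i\<in>I. \<exists>S\<in>A i. \<chi> ` S \<subseteq> {i} \<times> {..<b}" by (auto simp: B_def)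
  then obtain R where R: "\<And>i. i \<in> I \<Longrightarrow> R i \<in> A i \<and> \<chi> ` R i \<subseteq> {i} \<times> {..<b}" by metis
  have "R i \<inter> R j = {}" if "i \<in> I" "j \<in> I" "i \<noteq> j" for i j
    using R[OF that(1)] R[OF that(2)] that(3) by fastforce
  then show ?thesis using R by blast
qed simp

section \<open>Cores\<close>

text \<open>\<open>B\<close> may be any subfamily, not just all members of \<open>F\<close>
  containing \<open>Y\<close>. This makes the notion monotone in \<open>F\<close>: a core found
  after earlier removals is also a core of the original family.\<close>

definition spread_core :: "real \<Rightarrow> 'a set set \<Rightarrow> 'a set \<Rightarrow> bool" where
  "spread_core r F Y \<longleftrightarrow> (\<exists>B\<subseteq>F. B \<noteq> {} \<and> (\<forall>S\<in>B. Y \<subseteq> S) \<and>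
    (\<forall>Z. Y \<subseteq> Z \<longrightarrow> real (card {S\<in>B. Z \<subseteq> S}) * r ^ card (Z - Y) \<le> real (card B)))"

lemma spread_core_mono: "spread_core r F Y \<Longrightarrow> F \<subseteq> F' \<Longrightarrow> spread_core r F' Y"
  unfolding spread_core_def by (meson subset_trans)

lemma card_hitting_le:
  assumes "finite V" "finite G" "\<And>S. S \<in> A \<Longrightarrow> S \<in> G \<and> S \<inter> V \<noteq> {}"
  shows "real (card A) \<le> (\<Sum>v\<in>V. real (card {S\<in>G. v \<in> S}))"
proof -
  have "A \<subseteq> (\<Union>v\<in>V. {S\<in>G. v \<in> S})" using assms(3) by blast
  moreover have "finite (\<Union>v\<in>V. {S\<in>G. v \<in> S})" using assms by (intro finite_UN_I) auto
  ultimately have "card A \<le> card (\<Union>v\<in>V. {S\<in>G. v \<in> S})" by (intro card_mono)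
  also have "\<dots> \<le> (\<Sum>v\<in>V. card {S\<in>G. v \<in> S})" using assms(1) by (rule card_UN_le)
  finally show ?thesis by (metis of_nat_mono of_nat_sum)
qed

text \<open>The other cores have at most \<open>card I * b\<close> points, that is
  \<open>r / 100\<close>, and each of these points lies in at most a fraction \<open>1 / r\<close>
  of \<open>B i\<close>. Hence only one percent of \<open>B i\<close> meets another core. What
  remains is still spread once \<open>Y i\<close> is cut off, and putting the cores back preserves
  disjointness.\<close>

lemma disjoint_cores_matching:
  fixes X :: "'a set" and Y :: "'i \<Rightarrow> 'a set"
  assumes finX: "finite X" and FX: "F \<subseteq> Pow X" and finI: "finite I"
    and core: "\<And>i. i \<in> I \<Longrightarrow> spread_core (100 * (real (card I) * real b)) F (Y i)"
    and small_core: "\<And>i. i \<in> I \<Longrightarrow> card (Y i) \<le> b"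
    and disj: "\<And>i j. i \<in> I \<Longrightarrow> j \<in> I \<Longrightarrow> i \<noteq> j \<Longrightarrow> Y i \<inter> Y j = {}"
    and k: "\<And>S. S \<in> F \<Longrightarrow> card S \<le> k"
    and small: "real (card I) * ((3 / 5) ^ b * real k) < 1" and b: "0 < b"
  shows "\<exists>R. (\<forall>i\<in>I. R i \<in> F) \<and> (\<forall>i\<in>I. \<forall>j\<in>I. i \<noteq> j \<longrightarrow> R i \<inter> R j = {})"
proof -
  define r where "r = 100 * (real (card I) * real b)"
  have finF: "finite F" using FX finX by (meson finite_Pow_iff finite_subset)
  have "\<forall>i\<in>I. \<exists>B\<subseteq>F. B \<noteq> {} \<and> (\<forall>S\<in>B. Y i \<subseteq> S) \<and>
    (\<forall>Z. Y i \<subseteq> Z \<longrightarrow> real (card {S\<in>B. Z \<subseteq> S}) * r ^ card (Z - Y i) \<le> real (card B))"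
    using core unfolding spread_core_def r_def by blast
  from bchoice[OF this] obtain B where Bp: "\<forall>i\<in>I. B i \<subseteq> F \<and> B i \<noteq> {} \<and> (\<forall>S\<in>B i. Y i \<subseteq> S) \<and>
    (\<forall>Z. Y i \<subseteq> Z \<longrightarrow> real (card {S\<in>B i. Z \<subseteq> S}) * r ^ card (Z - Y i) \<le> real (card (B i)))"
    by blast
  then have BF: "\<And>i. i \<in> I \<Longrightarrow> B i \<subseteq> F" and Bne: "\<And>i. i \<in> I \<Longrightarrow> B i \<noteq> {}"
    and BY: "\<And>i S. i \<in> I \<Longrightarrow> S \<in> B i \<Longrightarrow> Y i \<subseteq> S"
    and Bsp: "\<And>i Z. i \<in> I \<Longrightarrow> Y i \<subseteq> Z \<Longrightarrow>
        real (card {S\<in>B i. Z \<subseteq> S}) * r ^ card (Z - Y i) \<le> real (card (B i))"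
    by blast+
  define V where "V i = (\<Union>j\<in>I - {i}. Y j)" for i
  define G where "G i = {S\<in>B i. S \<inter> V i = {}}" for i
  define A where "A i = (\<lambda>S. S - Y i) ` G i" for i
  have finB: "finite (B i)" if "i \<in> I" for i using BF[OF that] finF finite_subset by blast
  have finY: "finite (Y i)" if "i \<in> I" for i
  proof -
    obtain S where "S \<in> B i" using Bne \<open>i \<in> I\<close> by blast
    then show ?thesis using BY[of i S] BF[of i] FX finX that by (meson PowD finite_subset subsetD)
  qed
  have rpos: "0 < r" if "i \<in> I" for i
  proof -
    have "0 < card I" using that finI by (auto simp: card_gt_0_iff)
    then show ?thesis using b unfolding r_def by simp
  qed
  have cV: "real (card (V i)) \<le> r / 100" if "i \<in> I" for i
  proof -
    have "card (V i) \<le> (\<Sum>j\<in>I - {i}. card (Y j))" unfolding V_def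
      using finI by (intro card_UN_le) auto
    also have "\<dots> \<le> card (I - {i}) * b" using small_core sum_bounded_above[of "I - {i}" "\<lambda>j. card (Y j)" b] by simp
    also have "\<dots> \<le> card I * b" using finI by (intro mult_right_mono card_mono) auto
    finally have "real (card (V i)) \<le> real (card I * b)" by (rule of_nat_mono)
    then show ?thesis unfolding r_def by simp
  qed
  have GB: "real (card (B i)) \<le> 2 * real (card (G i))" if i: "i \<in> I" for i
  proof -
    have "finite (V i)" unfolding V_def using finI finY by auto
    then have "real (card (B i - G i)) \<le> (\<Sum>v\<in>V i. real (card {S\<in>B i. v \<in> S}))"
      using finB[OF i] by (rule card_hitting_le) (auto simp: G_def)
    also have "\<dots> \<le> real (card (V i)) * (real (card (B i)) / r)"
    proof (rule sum_bounded_above)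
      fix v assume "v \<in> V i"
      then have "v \<notin> Y i" unfolding V_def using disj[of i] i by auto
      then have "insert v (Y i) - Y i = {v}" by auto
      moreover have "{S\<in>B i. insert v (Y i) \<subseteq> S} = {S\<in>B i. v \<in> S}" using BY[OF i] by auto
      ultimately have "real (card {S\<in>B i. v \<in> S}) * r \<le> real (card (B i))"
        using Bsp[OF i, of "insert v (Y i)"] by auto
      then show "real (card {S\<in>B i. v \<in> S}) \<le> real (card (B i)) / r"
        using rpos[OF i] by (simp add: pos_le_divide_eq)
    qed
    also have "\<dots> \<le> r / 100 * (real (card (B i)) / r)"
      using cV[OF i] rpos[OF i] by (intro mult_right_mono) auto
    also have "\<dots> = real (card (B i)) / 100" using rpos[OF i] by simp
    finally have "real (card (B i - G i)) \<le> real (card (B i)) / 100" .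
    moreover have "card (B i - G i) = card (B i) - card (G i)"
      using finB[OF i] by (intro card_Diff_subset) (auto simp: G_def)
    moreover have "card (G i) \<le> card (B i)" using finB[OF i] by (intro card_mono) (auto simp: G_def)
    ultimately show ?thesis by linarith
  qed
  have injA: "inj_on (\<lambda>S. S - Y i) (G i)" if "i \<in> I" for i
    using BY[OF that] unfolding inj_on_def G_def by blast
  have cA: "card (A i) = card (G i)" if "i \<in> I" for i
    unfolding A_def using card_image[OF injA[OF that]] .
  have "\<exists>R. (\<forall>i\<in>I. R i \<in> A i) \<and> (\<forall>i\<in>I. \<forall>j\<in>I. i \<noteq> j \<longrightarrow> R i \<inter> R j = {})"
  \<comment> \<open>\<open>L = 2\<close> pays for the passage from \<open>B i\<close> to
    \<open>G i\<close>, and \<open>\<rho> = 1 / 100\<close> is the factor 100 in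
    \<open>r\<close>.\<close>
  proof (rule rainbow_disjoint_sets[OF finX finI, where L = 2 and \<rho> = "1 / 100" and b = b and k = k])
    fix i assume i: "i \<in> I"
    show "A i \<subseteq> Pow X" unfolding A_def G_def using BF[OF i] FX by auto
    have "0 < card (B i)" using Bne[OF i] finB[OF i] by (simp add: card_gt_0_iff)
    then have "0 < card (A i)" using GB[OF i] cA[OF i] by simp
    then show "A i \<noteq> {}" by auto
    show "card S \<le> k" if SA: "S \<in> A i" for S
    proof -
      obtain S' where "S' \<in> G i" "S = S' - Y i" using SA unfolding A_def by auto
      then have "S' \<in> F" "S \<subseteq> S'" using BF[OF i] unfolding G_def by auto
      then show ?thesis using k[of S'] FX finX by (meson PowD card_mono finite_subset le_trans subsetD)
    qed
    fix Z assume Z: "Z \<subseteq> X" "Z \<noteq> {}"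
    show "real (card {S \<in> A i. Z \<subseteq> S}) * (real (card I) * real b) ^ card Z
         \<le> 2 * real (card (A i)) * (1 / 100) ^ card Z"
    proof (cases "Z \<inter> Y i = {}")
      case False
      then have none: "{S \<in> A i. Z \<subseteq> S} = {}" unfolding A_def by auto
      show ?thesis unfolding none by simp
    next
      case True
      have "{S \<in> A i. Z \<subseteq> S} \<subseteq> (\<lambda>S. S - Y i) ` {S\<in>B i. Y i \<union> Z \<subseteq> S}"
        unfolding A_def G_def using BY[OF i] by auto
      then have "card {S \<in> A i. Z \<subseteq> S} \<le> card {S\<in>B i. Y i \<union> Z \<subseteq> S}"
        using finB[OF i] by (intro surj_card_le) auto
      then have "real (card {S \<in> A i. Z \<subseteq> S}) * r ^ card Z \<le> real (card {S\<in>B i. Y i \<union> Z \<subseteq> S}) * r ^ card Z"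
        using rpos[OF i] by (intro mult_right_mono) auto
      moreover have "Y i \<union> Z - Y i = Z" using True by auto
      ultimately have "real (card {S \<in> A i. Z \<subseteq> S}) * r ^ card Z \<le> real (card (B i))"
        using Bsp[OF i, of "Y i \<union> Z"] by auto
      also have "\<dots> \<le> 2 * real (card (A i))" using GB[OF i] cA[OF i] by simp
      finally have "real (card {S \<in> A i. Z \<subseteq> S}) * r ^ card Z * (1 / 100) ^ card Z \<le> 2 * real (card (A i)) * (1 / 100) ^ card Z"
        by (intro mult_right_mono) auto
      moreover have "r ^ card Z * (1 / 100) ^ card Z = (real (card I) * real b) ^ card Z"
        unfolding r_def by (subst power_mult_distrib[symmetric]) simp
      ultimately show ?thesis by (simp add: mult.assoc)
    qed
  qed (use small b in auto)
  then obtain R where R: "\<And>i. i \<in> I \<Longrightarrow> R i \<in> A i"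
    and Rd: "\<And>i j. i \<in> I \<Longrightarrow> j \<in> I \<Longrightarrow> i \<noteq> j \<Longrightarrow> R i \<inter> R j = {}" by blast
  have "\<forall>i\<in>I. \<exists>S\<in>G i. R i = S - Y i" using R unfolding A_def by auto
  then obtain Q where Q: "\<And>i. i \<in> I \<Longrightarrow> Q i \<in> G i \<and> R i = Q i - Y i" by metis
  have "Q i \<inter> Q j = {}" if "i \<in> I" "j \<in> I" "i \<noteq> j" for i j
  proof -
    have "Q i \<inter> Y j = {}" "Q j \<inter> Y i = {}"
      using Q[OF that(1)] Q[OF that(2)] that unfolding G_def V_def by auto
    then show ?thesis using Rd[OF that] Q[OF that(1)] Q[OF that(2)] by blast
  qed
  moreover have "Q i \<in> F" if "i \<in> I" for i using Q[OF that] BF[OF that] unfolding G_def by auto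
  ultimately show ?thesis by blast
qed

text \<open>The cores are found greedily: take a nonempty \<open>Y\<close> maximising \<open>r ^ card Y\<close> times the number
  of members containing \<open>Y\<close>, remove these members, and repeat. Comparing \<open>Y\<close> with singletons
  bounds all degrees at that moment in terms of \<open>card Y\<close>.\<close>

lemma core_decomposition:
  fixes X :: "'a set" and \<Delta> :: "nat \<Rightarrow> real"
  assumes finX: "finite X" and r: "0 < r"
    and \<Delta>: "\<And>j. 0 \<le> \<Delta> j" "\<And>j. q < j \<Longrightarrow> \<Delta> j \<le> \<epsilon>" and \<epsilon>: "0 \<le> \<epsilon>"
    and FX: "F \<subseteq> Pow X" and Fne: "{} \<notin> F"
    and deg: "\<And>Y. Y \<subseteq> X \<Longrightarrow> Y \<noteq> {} \<Longrightarrow> real (card {S\<in>F. Y \<subseteq> S}) * r ^ (card Y - 1) \<le> \<Delta> (card Y)"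
  shows "\<exists>K R F'. (\<forall>Y\<in>K. Y \<subseteq> X \<and> Y \<noteq> {} \<and> card Y \<le> q \<and> spread_core r F Y)
      \<and> F = F' \<union> (\<Union>j\<in>{1..q}. R j)
      \<and> (\<forall>j. \<forall>S\<in>R j. \<exists>Y\<in>K. card Y = j \<and> Y \<subseteq> S)
      \<and> (\<forall>j v. real (card {S\<in>R j. v \<in> S}) \<le> \<Delta> j)
      \<and> (\<forall>v. real (card {S\<in>F'. v \<in> S}) \<le> \<epsilon>) \<and> (\<forall>j. R j \<subseteq> F)"
  using FX Fne deg
proof (induction "card F" arbitrary: F rule: less_induct)
  case less
  note FX = less.prems(1) and Fne = less.prems(2) and deg = less.prems(3)
  have finF: "finite F" using FX finX by (meson finite_Pow_iff finite_subset)
  show ?case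
  proof (cases "F = {}")
    case True
    show ?thesis
      by (rule exI[of _ "{}"], rule exI[of _ "\<lambda>_. {}"], rule exI[of _ "{}"]) (use True \<Delta> \<epsilon> in auto)
  next
    case False
    define f where "f Y = real (card {S\<in>F. Y \<subseteq> S}) * r ^ card Y" for Y
    define P where "P = {Y. Y \<subseteq> X \<and> Y \<noteq> {}}"
    obtain S0 where S0: "S0 \<in> F" using False by blast
    then have S0P: "S0 \<in> P" using FX Fne unfolding P_def by blast
    have "finite P" unfolding P_def using finX by (auto intro: finite_subset[of _ "Pow X"])
    then have "finite (f ` P)" "f ` P \<noteq> {}" using S0P by auto
    then have "Max (f ` P) \<in> f ` P" "\<And>Z. Z \<in> P \<Longrightarrow> f Z \<le> Max (f ` P)" by auto
    then obtain Y where YP: "Y \<in> P" and Ymax: "\<And>Z. Z \<in> P \<Longrightarrow> f Z \<le> f Y" by auto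
    define B where "B = {S\<in>F. Y \<subseteq> S}"
    have finY: "finite Y" using YP finX finite_subset unfolding P_def by blast
    have cY: "card Y \<noteq> 0" using YP finY unfolding P_def by auto
    have "S0 \<in> {S\<in>F. S0 \<subseteq> S}" using S0 by auto
    then have "0 < card {S\<in>F. S0 \<subseteq> S}" using finF by (auto simp: card_gt_0_iff)
    then have "0 < f S0" unfolding f_def using r by simp
    then have "0 < f Y" using Ymax[OF S0P] by simp
    then have "card B \<noteq> 0" unfolding f_def B_def by (intro notI) simp
    then have Bne: "B \<noteq> {}" by auto
    have degv: "real (card {S\<in>F. v \<in> S}) \<le> \<Delta> (card Y)" for v
    proof (cases "v \<in> X")
      case True
      then have "f {v} \<le> f Y" using Ymax unfolding P_def by auto
      then have "real (card {S\<in>F. v \<in> S}) * r \<le> real (card B) * r ^ (card Y - 1) * r"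
        unfolding f_def B_def using cY by (cases "card Y") (auto simp: mult_ac)
      then have "real (card {S\<in>F. v \<in> S}) \<le> real (card B) * r ^ (card Y - 1)" using r by simp
      also have "\<dots> \<le> \<Delta> (card Y)" using deg[of Y] YP unfolding P_def B_def by auto
      finally show ?thesis .
    next
      case False
      then have none: "{S\<in>F. v \<in> S} = {}" using FX by auto
      show ?thesis unfolding none using \<Delta>(1) by simp
    qed
    show ?thesis
    proof (cases "card Y \<le> q")
      \<comment> \<open>A maximiser with more than \<open>q\<close> elements ends the extraction: by
        \<open>degv\<close> all degrees are already at most \<open>\<epsilon>\<close>.\<close>
      case False
      then have "real (card {S\<in>F. v \<in> S}) \<le> \<epsilon>" for v using degv[of v] \<Delta>(2)[of "card Y"] by simp
      then show ?thesis
        by (intro exI[of _ "{}"] exI[of _ "\<lambda>_. {}"] exI[of _ F]) (use \<Delta> in auto)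
    next
      case True
      define G where "G = F - B"
      have GF: "G \<subseteq> F" unfolding G_def by auto
      have core: "spread_core r F Y" unfolding spread_core_def
      proof (intro exI[of _ B] conjI allI impI)
        fix Z assume YZ: "Y \<subseteq> Z"
        have BZ: "{S\<in>B. Z \<subseteq> S} = {S\<in>F. Z \<subseteq> S}" using YZ unfolding B_def by auto
        show "real (card {S\<in>B. Z \<subseteq> S}) * r ^ card (Z - Y) \<le> real (card B)"
        proof (cases "Z \<subseteq> X")
          case True
          then have "f Z \<le> f Y" using Ymax YZ YP unfolding P_def by auto
          moreover have "card Z = card (Z - Y) + card Y"
            using YZ True finX finY by (metis add.commute card_Diff_subset card_mono finite_subset le_add_diff_inverse)
          ultimately have "real (card {S\<in>B. Z \<subseteq> S}) * r ^ card (Z - Y) * r ^ card Y \<le> real (card B) * r ^ card Y"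
            unfolding f_def BZ by (simp add: B_def power_add mult.assoc)
          then show ?thesis using r by simp
        next
          case False
          then have none: "{S\<in>B. Z \<subseteq> S} = {}" using FX unfolding B_def by blast
          show ?thesis unfolding none by simp
        qed
      qed (use Bne in \<open>auto simp: B_def\<close>)
      have "\<exists>K R F'. (\<forall>Y\<in>K. Y \<subseteq> X \<and> Y \<noteq> {} \<and> card Y \<le> q \<and> spread_core r G Y)
        \<and> G = F' \<union> (\<Union>j\<in>{1..q}. R j)
        \<and> (\<forall>j. \<forall>S\<in>R j. \<exists>Y\<in>K. card Y = j \<and> Y \<subseteq> S)
        \<and> (\<forall>j v. real (card {S\<in>R j. v \<in> S}) \<le> \<Delta> j)
        \<and> (\<forall>v. real (card {S\<in>F'. v \<in> S}) \<le> \<epsilon>) \<and> (\<forall>j. R j \<subseteq> G)"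
      proof (rule less.hyps)
        show "card G < card F" unfolding G_def
          using Bne finF by (intro psubset_card_mono) (auto simp: B_def)
        show "G \<subseteq> Pow X" "{} \<notin> G" using GF FX Fne by auto
        show "real (card {S\<in>G. Y \<subseteq> S}) * r ^ (card Y - 1) \<le> \<Delta> (card Y)"
          if "Y \<subseteq> X" "Y \<noteq> {}" for Y
        proof -
          have "card {S\<in>G. Y \<subseteq> S} \<le> card {S\<in>F. Y \<subseteq> S}"
            using GF finF by (intro card_mono) auto
          then have "real (card {S\<in>G. Y \<subseteq> S}) * r ^ (card Y - 1) \<le> real (card {S\<in>F. Y \<subseteq> S}) * r ^ (card Y - 1)"
            using r by (intro mult_right_mono) auto
          then show ?thesis using deg[OF that] by linarith
        qed
      qed
      then obtain K R F' where K: "\<forall>Y\<in>K. Y \<subseteq> X \<and> Y \<noteq> {} \<and> card Y \<le> q \<and> spread_core r G Y"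
        and cov: "G = F' \<union> (\<Union>j\<in>{1..q}. R j)"
        and RK: "\<forall>j. \<forall>S\<in>R j. \<exists>Y\<in>K. card Y = j \<and> Y \<subseteq> S"
        and Rdeg: "\<forall>j v. real (card {S\<in>R j. v \<in> S}) \<le> \<Delta> j"
        and F'deg: "\<forall>v. real (card {S\<in>F'. v \<in> S}) \<le> \<epsilon>" and RG: "\<forall>j. R j \<subseteq> G"
        by blast
      define R' where "R' j = (if j = card Y then B \<union> R j else R j)" for j
      have R'F: "R' j \<subseteq> F" for j unfolding R'_def using RG GF by (auto simp: B_def)
      show ?thesis
      proof (rule exI[of _ "insert Y K"], rule exI[of _ R'], rule exI[of _ F'], intro conjI)
        show "\<forall>Y\<in>insert Y K. Y \<subseteq> X \<and> Y \<noteq> {} \<and> card Y \<le> q \<and> spread_core r F Y"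
          using K core True YP spread_core_mono[OF _ GF] unfolding P_def by auto
        have "card Y \<in> {1..q}" using True cY by simp
        then have "(\<Union>j\<in>{1..q}. R' j) = B \<union> (\<Union>j\<in>{1..q}. R j)"
          unfolding R'_def by (auto split: if_splits)
        then show "F = F' \<union> (\<Union>j\<in>{1..q}. R' j)" using cov unfolding G_def B_def by auto
        show "\<forall>j. \<forall>S\<in>R' j. \<exists>Y\<in>insert Y K. card Y = j \<and> Y \<subseteq> S"
          using RK unfolding R'_def B_def by auto
        show "\<forall>j v. real (card {S\<in>R' j. v \<in> S}) \<le> \<Delta> j"
        proof (intro allI)
          fix j v
          show "real (card {S\<in>R' j. v \<in> S}) \<le> \<Delta> j"
          proof (cases "j = card Y")
            \<comment> \<open>The bound does not add up over cores of equal size: all of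
              \<open>R' j\<close> lies in the current \<open>F\<close>, whose degrees were bounded
              when \<open>Y\<close> was chosen.\<close>
            case True
            have "card {S\<in>R' j. v \<in> S} \<le> card {S\<in>F. v \<in> S}"
              using R'F finF by (intro card_mono) auto
            then show ?thesis using degv[of v] True by simp
          next
            case False
            then show ?thesis using Rdeg unfolding R'_def by simp
          qed
        qed
      qed (use F'deg R'F in auto)
    qed
  qed
qed

section \<open>Members outside the stars of the singleton cores\<close>

lemma sum_geometric_tail_le: "(\<Sum>j=2..q. real j / 100 ^ (j - 1)) \<le> 1 / 32"
proof -
  \<comment> \<open>Since \<open>j \<le> 2 ^ (j - 1)\<close>, the terms are at most
    \<open>(1 / 50) ^ (j - 1)\<close>, and the right-hand side is their geometric sum. The target
    \<open>1 / 32\<close> is chosen to turn \<open>16 * D\<close> into \<open>D / 2\<close>.\<close>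
  have "(\<Sum>j=2..q. real j / 100 ^ (j - 1)) \<le> 1 / 49 - 50 / 49 * (1 / 50) ^ q"
    if "1 \<le> q" for q
    using that
  proof (induction q rule: nat_induct_at_least)
    case (Suc q)
    have "real (Suc q) \<le> 2 ^ q"
      by (metis Suc_leI less_exp of_nat_le_iff of_nat_numeral of_nat_power)
    then have "real (Suc q) / 100 ^ q \<le> 2 ^ q / 100 ^ q" by (intro divide_right_mono) auto
    also have "\<dots> = (1 / 50) ^ q" by (simp flip: power_divide)
    finally show ?case using Suc by simp
  qed simp
  note tail = this
  show ?thesis
  proof (cases "1 \<le> q")
    case True
    have "0 \<le> 50 / 49 * (1 / 50 :: real) ^ q" by simp
    then show ?thesis using tail[OF True] by linarith
  qed (simp add: not_le)
qed

text \<open>Take \<open>H\<close> to be the set of centres of singleton cores and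
  \<open>u = s - 1 - card H\<close>. Disjoint cores of size \<open>j\<close> off \<open>H\<close>
  number at most \<open>u\<close>, since they can be joined to the singletons. So
  \<open>u * j\<close> points suffice to meet every member removed through such a core, and the
  degrees \<open>16 * D / 100 ^ (j - 1)\<close> sum to at most \<open>u * (D / 2)\<close>. The bound
  \<open>b\<close> on core sizes is the one that disjoint cores need in order to be extended to a
  matching.\<close>

lemma star_structure:
  fixes X :: "'a set" and D :: real
  assumes finX: "finite X" and FX: "F \<subseteq> Pow X" and Fne: "{} \<notin> F" and s: "0 < s" and b: "0 < b"
    and no_matching: "\<And>M. M \<subseteq> F \<Longrightarrow> pairwise disjnt M \<Longrightarrow> card M < s"
    and k: "\<And>S. S \<in> F \<Longrightarrow> card S \<le> k" and small: "real s * ((3 / 5) ^ b * real k) < 1"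
    and D: "0 \<le> D"
    and deg: "\<And>Y. Y \<subseteq> X \<Longrightarrow> Y \<noteq> {} \<Longrightarrow> real (card {S\<in>F. Y \<subseteq> S}) *
        (100 * (real s * real b)) ^ (card Y - 1) \<le> 16 * D / 100 ^ (card Y - 1)"
  shows "\<exists>H\<subseteq>X. card H < s \<and>
    real (card {S\<in>F. S \<inter> H = {}}) \<le> real (s - 1 - card H) * (D / 2) + real (card X) * (16 * D / 100 ^ b)"
proof -
  define r where "r = 100 * (real s * real b)"
  define \<Delta> where "\<Delta> j = 16 * D / 100 ^ (j - 1)" for j :: nat
  have finF: "finite F" using FX finX by (meson finite_Pow_iff finite_subset)
  have "\<exists>K R F'. (\<forall>Y\<in>K. Y \<subseteq> X \<and> Y \<noteq> {} \<and> card Y \<le> b \<and> spread_core r F Y)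
      \<and> F = F' \<union> (\<Union>j\<in>{1..b}. R j)
      \<and> (\<forall>j. \<forall>S\<in>R j. \<exists>Y\<in>K. card Y = j \<and> Y \<subseteq> S)
      \<and> (\<forall>j v. real (card {S\<in>R j. v \<in> S}) \<le> \<Delta> j)
      \<and> (\<forall>v. real (card {S\<in>F'. v \<in> S}) \<le> 16 * D / 100 ^ b) \<and> (\<forall>j. R j \<subseteq> F)"
  proof (rule core_decomposition[OF finX _ _ _ _ FX Fne])
    show "\<Delta> j \<le> 16 * D / 100 ^ b" if "b < j" for j
      unfolding \<Delta>_def using that D by (intro divide_left_mono power_increasing) auto
  qed (use s b D deg in \<open>auto simp: r_def \<Delta>_def\<close>)
  then obtain K R F' where K': "\<forall>Y\<in>K. Y \<subseteq> X \<and> Y \<noteq> {} \<and> card Y \<le> b \<and> spread_core r F Y"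
    and cov: "F = F' \<union> (\<Union>j\<in>{1..b}. R j)"
    and RK': "\<forall>j. \<forall>S\<in>R j. \<exists>Y\<in>K. card Y = j \<and> Y \<subseteq> S"
    and Rdeg': "\<forall>j v. real (card {S\<in>R j. v \<in> S}) \<le> \<Delta> j"
    and F'deg': "\<forall>v. real (card {S\<in>F'. v \<in> S}) \<le> 16 * D / 100 ^ b"
    and RF': "\<forall>j. R j \<subseteq> F"
    by (elim exE conjE) (rule that)
  note K = bspec[OF K'] and RK = bspec[OF spec[OF RK']] and Rdeg = Rdeg'[rule_format]
    and F'deg = F'deg'[rule_format] and RF = RF'[rule_format]
  have "K \<subseteq> Pow X" using K by blast
  then have finK: "finite K" using finX by (meson finite_Pow_iff finite_subset)
  have few: "card Z < s" if ZK: "Z \<subseteq> K" and dis: "pairwise disjnt Z" for Z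
  proof (rule ccontr)
    assume "\<not> card Z < s"
    then obtain I where I: "I \<subseteq> Z" "card I = s" "finite I" by (metis not_le obtain_subset_with_card_n)
    have "\<exists>R. (\<forall>i\<in>I. R i \<in> F) \<and> (\<forall>i\<in>I. \<forall>j\<in>I. i \<noteq> j \<longrightarrow> R i \<inter> R j = {})"
    proof (rule disjoint_cores_matching[OF finX FX I(3), where Y = "\<lambda>i. i" and b = b and k = k])
      show "spread_core (100 * (real (card I) * real b)) F i" "card i \<le> b" if "i \<in> I" for i
        using K[of i] that I ZK unfolding r_def by auto
      show "i \<inter> j = {}" if "i \<in> I" "j \<in> I" "i \<noteq> j" for i j
        using that I dis unfolding pairwise_def disjnt_def by blast
    qed (use k small b I in auto)
    then obtain Q where "\<forall>i\<in>I. Q i \<in> F" "\<forall>i\<in>I. \<forall>j\<in>I. i \<noteq> j \<longrightarrow> Q i \<inter> Q j = {}"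
      by (elim exE conjE) (rule that)
    note Q = this[rule_format]
    have "inj_on Q I"
    proof (rule inj_onI, rule ccontr)
      fix i j assume "i \<in> I" "j \<in> I" "Q i = Q j" "i \<noteq> j"
      then have "Q i = {}" using Q(2)[of i j] by auto
      then show False using Q(1)[OF \<open>i \<in> I\<close>] Fne by auto
    qed
    then have "card (Q ` I) = s" using I by (simp add: card_image)
    moreover have "pairwise disjnt (Q ` I)" unfolding pairwise_def disjnt_def using Q(2) by auto
    moreover have "Q ` I \<subseteq> F" using Q(1) by auto
    ultimately show False using no_matching[of "Q ` I"] by simp
  qed
  define H where "H = {v. {v} \<in> K}"
  define u where "u = s - 1 - card H"
  have HX: "H \<subseteq> X" using K unfolding H_def by blast
  have finH: "finite H" using HX finX finite_subset by blast
  define singles where "singles = (\<lambda>v. {v}) ` H"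
  have singlesK: "singles \<subseteq> K" unfolding singles_def H_def by auto
  have csingles: "card singles = card H" unfolding singles_def by (intro card_image) (auto simp: inj_on_def)
  have dsingles: "pairwise disjnt singles" unfolding singles_def pairwise_def disjnt_def by auto
  have cH: "card H < s" using few[OF singlesK dsingles] csingles by simp
  define F0 where "F0 = {S\<in>F. S \<inter> H = {}}"
  have Rbound: "real (card (R j \<inter> F0)) \<le> real u * 16 * D * (real j / 100 ^ (j - 1))" if "2 \<le> j" for j
  proof -
    define Kj where "Kj = {Y\<in>K. card Y = j \<and> Y \<inter> H = {}}"
    define P where "P M \<longleftrightarrow> M \<subseteq> Kj \<and> pairwise disjnt M" for M
    have finKj: "finite Kj" unfolding Kj_def using finK by auto
    \<comment> \<open>A largest disjoint family of these cores; by maximality its union meets all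
      the others.\<close>
    have "\<exists>M. P M \<and> (\<forall>M'. P M' \<longrightarrow> card M' \<le> card M)"
    proof (rule ex_has_greatest_nat[of P "{}"])
      show "P {}" unfolding P_def by (simp add: pairwise_def)
      show "\<forall>M. P M \<longrightarrow> card M < Suc (card Kj)"
        using finKj unfolding P_def by (auto simp: less_Suc_eq_le intro: card_mono)
    qed
    then obtain M where PM: "P M" and Mmax': "\<forall>M'. P M' \<longrightarrow> card M' \<le> card M" by blast
    note Mmax = Mmax'[rule_format]
    have M: "M \<subseteq> Kj" "pairwise disjnt M" using PM unfolding P_def by auto
    have finM: "finite M" using M finKj finite_subset by blast
    have "card (singles \<union> M) < s"
    proof (rule few)
      show "singles \<union> M \<subseteq> K" using singlesK M unfolding Kj_def by auto
      have "disjnt Y Z" if "Y \<in> singles" "Z \<in> M" for Y Z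
        using that M unfolding singles_def Kj_def disjnt_def by auto
      then show "pairwise disjnt (singles \<union> M)"
        using dsingles M(2) unfolding pairwise_def by (auto simp: disjnt_sym)
    qed
    moreover have "card (singles \<union> M) = card H + card M"
    proof -
      have "singles \<inter> M = {}" using M(1) that unfolding singles_def Kj_def by auto
      then show ?thesis using csingles finH finM by (subst card_Un_disjoint) (auto simp: singles_def)
    qed
    ultimately have cM: "card M \<le> u" unfolding u_def by simp
    have finY: "finite Y" if "Y \<in> M" for Y
      using that M(1) K[of Y] finite_subset[OF _ finX, of Y] unfolding Kj_def by auto
    have cV: "card (\<Union>M) \<le> u * j"
    proof -
      have "card (\<Union>M) \<le> (\<Sum>Y\<in>M. card Y)" by (rule card_Union_le_sum_card)
      also have "\<dots> = card M * j" using M unfolding Kj_def by (simp add: subset_iff)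
      also have "\<dots> \<le> u * j" using cM by simp
      finally show ?thesis .
    qed
    have "real (card (R j \<inter> F0)) \<le> (\<Sum>v\<in>\<Union>M. real (card {S\<in>R j. v \<in> S}))"
    proof (rule card_hitting_le)
      show "finite (\<Union>M)" using finM finY by auto
      show "finite (R j)" using RF finF finite_subset by blast
      fix S assume S: "S \<in> R j \<inter> F0"
      then obtain Y where Y: "Y \<in> K" "card Y = j" "Y \<subseteq> S" using RK by blast
      then have YKj: "Y \<in> Kj" using S unfolding F0_def Kj_def by auto
      have "Y \<inter> \<Union>M \<noteq> {}"
      proof
        assume e: "Y \<inter> \<Union>M = {}"
        have "Y \<noteq> {}" using Y(1) K by blast
        then have "Y \<notin> M" using e by auto
        moreover have "P (insert Y M)" using M YKj e
          unfolding P_def pairwise_def disjnt_def by blast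
        ultimately show False using Mmax[of "insert Y M"] finM by simp
      qed
      then show "S \<in> R j \<and> S \<inter> \<Union>M \<noteq> {}" using S Y(3) by blast
    qed
    also have "\<dots> \<le> real (card (\<Union>M)) * \<Delta> j" by (rule sum_bounded_above) (rule Rdeg)
    also have "\<dots> \<le> real (u * j) * \<Delta> j"
      using cV D by (intro mult_right_mono of_nat_mono) (auto simp: \<Delta>_def)
    finally show ?thesis by (simp add: \<Delta>_def mult_ac)
  qed
  have F'X: "real (card F') \<le> real (card X) * (16 * D / 100 ^ b)"
  proof -
    have "finite F'" using cov finF by auto
    with finX have "real (card F') \<le> (\<Sum>v\<in>X. real (card {S\<in>F'. v \<in> S}))"
    proof (rule card_hitting_le)
      fix S assume S: "S \<in> F'"
      then have "S \<in> F" using cov by simp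
      then have "S \<noteq> {}" "S \<subseteq> X" using FX Fne by auto
      then show "S \<in> F' \<and> S \<inter> X \<noteq> {}" using S by auto
    qed
    also have "\<dots> \<le> real (card X) * (16 * D / 100 ^ b)" by (rule sum_bounded_above) (rule F'deg)
    finally show ?thesis .
  qed
  have R1: "R 1 \<inter> F0 = {}"
  proof -
    have False if S: "S \<in> R 1" "S \<in> F0" for S
    proof -
      obtain Y where "Y \<in> K" "card Y = 1" "Y \<subseteq> S" using RK[OF S(1)] by blast
      moreover then obtain v where "Y = {v}" by (auto simp: card_1_singleton_iff)
      ultimately show False using S(2) unfolding F0_def H_def by auto
    qed
    then show ?thesis by blast
  qed
  have "F0 \<subseteq> F' \<union> (\<Union>j\<in>{2..b}. R j \<inter> F0)"
  proof
    fix S assume S: "S \<in> F0"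
    then consider "S \<in> F'" | j where "j \<in> {1..b}" "S \<in> R j" using cov unfolding F0_def by blast
    then show "S \<in> F' \<union> (\<Union>j\<in>{2..b}. R j \<inter> F0)"
    proof cases
      case 2
      then have "j \<noteq> 1" using R1 S by auto
      then have "j \<in> {2..b}" using 2 by auto
      then show ?thesis using 2 S by blast
    qed auto
  qed
  moreover have "finite F'" "finite F0" using cov finF by (auto simp: F0_def)
  ultimately have "card F0 \<le> card F' + card (\<Union>j\<in>{2..b}. R j \<inter> F0)"
    by (intro order_trans[OF card_mono card_Un_le]) auto
  also have "card (\<Union>j\<in>{2..b}. R j \<inter> F0) \<le> (\<Sum>j=2..b. card (R j \<inter> F0))"
    by (rule card_UN_le) auto
  finally have "real (card F0) \<le> real (card F' + (\<Sum>j=2..b. card (R j \<inter> F0)))"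
    by (rule of_nat_mono) simp
  also have "\<dots> = real (card F') + (\<Sum>j=2..b. real (card (R j \<inter> F0)))" by simp
  also have "(\<Sum>j=2..b. real (card (R j \<inter> F0))) \<le> (\<Sum>j=2..b. real u * 16 * D * (real j / 100 ^ (j - 1)))"
    by (intro sum_mono Rbound) auto
  also have "\<dots> = real u * 16 * D * (\<Sum>j=2..b. real j / 100 ^ (j - 1))"
    by (simp add: sum_distrib_left)
  also have "\<dots> \<le> real u * 16 * D * (1 / 32)"
    using D by (intro mult_left_mono sum_geometric_tail_le) auto
  also have "\<dots> = real u * (D / 2)" by simp
  finally have "real (card F0) \<le> real u * (D / 2) + real (card X) * (16 * D / 100 ^ b)"
    using F'X by linarith
  then show ?thesis using HX cH unfolding F0_def u_def by blast
qed

section \<open>Counting permutations\<close>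

definition perm_graph :: "nat \<Rightarrow> (nat \<Rightarrow> nat) \<Rightarrow> (nat \<times> nat) set" where
  "perm_graph n \<pi> = (\<lambda>i. (i, \<pi> i)) ` {1..n}"

lemma mem_perm_graph [simp]: "(i, j) \<in> perm_graph n \<pi> \<longleftrightarrow> i \<in> {1..n} \<and> \<pi> i = j"
  unfolding perm_graph_def by auto

lemma card_perm_graph: "card (perm_graph n \<pi>) = n"
  unfolding perm_graph_def by (subst card_image) (auto simp: inj_on_def)

lemma perm_graph_subset: "\<pi> permutes {1..n} \<Longrightarrow> perm_graph n \<pi> \<subseteq> {1..n} \<times> {1..n}"
  unfolding perm_graph_def by (auto dest: permutes_in_image)

lemma inj_on_perm_graph: "inj_on (perm_graph n) {\<pi>. \<pi> permutes {1..n}}"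
proof (rule inj_onI)
  fix \<pi> \<tau> assume p: "\<pi> \<in> {\<pi>. \<pi> permutes {1..n}}" "\<tau> \<in> {\<pi>. \<pi> permutes {1..n}}"
    and eq: "perm_graph n \<pi> = perm_graph n \<tau>"
  show "\<pi> = \<tau>"
  proof
    fix i show "\<pi> i = \<tau> i"
    proof (cases "i \<in> {1..n}")
      case True
      then have "(i, \<pi> i) \<in> perm_graph n \<tau>" by (simp flip: eq)
      then show ?thesis by simp
    qed (use p in \<open>auto simp: permutes_def\<close>)
  qed
qed

lemma perm_intersect_iff: "perm_intersect n \<sigma> \<tau> \<longleftrightarrow> perm_graph n \<sigma> \<inter> perm_graph n \<tau> \<noteq> {}"
  unfolding perm_intersect_def perm_graph_def by auto

text \<open>The falling factorial \<open>m! / (m - j)!\<close> is at least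
  \<open>(m / 3) ^ j\<close> for all \<open>j\<close> up to \<open>m\<close>; this is the spreadness
  of permutations. Replacing \<open>m\<close> by \<open>m + 1\<close> multiplies
  \<open>(m / 3) ^ i\<close> by \<open>(1 + 1 / m) ^ i\<close>, which is at most
  \<open>exp 1\<close>, and the 3 absorbs it.\<close>

lemma fact_diff_mult_power_le:
  assumes "j \<le> m"
  shows "fact (m - j) * (real m / 3) ^ j \<le> fact m"
  using assms
proof (induction m arbitrary: j)
  case (Suc m)
  show ?case
  proof (cases j)
    case (Suc i)
    then have i: "i \<le> m" using Suc.prems by simp
    show ?thesis
    proof (cases "m = 0")
      case True
      then show ?thesis using i Suc by simp
    next
      case False
      have "(1 + 1 / real m) ^ i \<le> (1 + 1 / real m) ^ m"
        using i by (intro power_increasing) auto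
      also have "\<dots> \<le> exp (1 / real m) ^ m" by (intro power_mono exp_ge_add_one_self) auto
      also have "\<dots> = exp 1" using False by (simp flip: exp_of_nat_mult)
      also have "\<dots> \<le> 3" by (rule exp_le)
      finally have e: "(1 + 1 / real m) ^ i \<le> 3" .
      have "real (Suc m) / 3 = real m / 3 * (1 + 1 / real m)" using False by (simp add: field_simps)
      then have "(real (Suc m) / 3) ^ i = (real m / 3 * (1 + 1 / real m)) ^ i"
        by (rule arg_cong)
      also have "\<dots> = (real m / 3) ^ i * (1 + 1 / real m) ^ i"
        by (rule power_mult_distrib)
      also have "\<dots> \<le> (real m / 3) ^ i * 3" using e by (intro mult_left_mono) auto
      finally have "real (Suc m) / 3 * (real (Suc m) / 3) ^ i \<le> real (Suc m) / 3 * ((real m / 3) ^ i * 3)"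
        by (intro mult_left_mono) auto
      then have "(real (Suc m) / 3) ^ j \<le> real (Suc m) * (real m / 3) ^ i"
        using Suc by (simp add: algebra_simps)
      then have "fact (Suc m - j) * (real (Suc m) / 3) ^ j \<le> fact (m - i) * (real (Suc m) * (real m / 3) ^ i)"
        using Suc by (intro mult_mono) auto
      also have "\<dots> = real (Suc m) * (fact (m - i) * (real m / 3) ^ i)" by simp
      also have "\<dots> \<le> real (Suc m) * fact m" using Suc.IH[OF i] by (intro mult_left_mono) auto
      finally show ?thesis by simp
    qed
  qed simp
qed simp

lemma card_permutations_agreeing:
  assumes "finite A" "p permutes A" "B \<subseteq> A"
  shows "card {q. q permutes A \<and> (\<forall>i\<in>B. q i = p i)} = fact (card A - card B)"
proof -
  have "bij_betw (\<lambda>q. p \<circ> q) {q. q permutes A - B} {q. q permutes A \<and> (\<forall>i\<in>B. q i = p i)}"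
  proof (rule bij_betw_byWitness[where f' = "\<lambda>q. inv p \<circ> q"])
    have inv: "inv p \<circ> p = id" "p \<circ> inv p = id"
      using permutes_inv_o[OF assms(2)] by auto
    show "\<forall>q\<in>{q. q permutes A - B}. inv p \<circ> (p \<circ> q) = q" using inv by (simp add: o_assoc)
    show "\<forall>q\<in>{q. q permutes A \<and> (\<forall>i\<in>B. q i = p i)}. p \<circ> (inv p \<circ> q) = q"
      using inv by (simp add: o_assoc)
    show "(\<lambda>q. p \<circ> q) ` {q. q permutes A - B} \<subseteq> {q. q permutes A \<and> (\<forall>i\<in>B. q i = p i)}"
    proof clarify
      fix q assume q: "q permutes A - B"
      have "q permutes A" by (rule permutes_subset[OF q]) auto
      then have "p \<circ> q permutes A" using assms(2) by (rule permutes_compose)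
      moreover have "q i = i" if "i \<in> B" for i using q that unfolding permutes_def by auto
      ultimately show "p \<circ> q permutes A \<and> (\<forall>i\<in>B. (p \<circ> q) i = p i)" by simp
    qed
    show "(\<lambda>q. inv p \<circ> q) ` {q. q permutes A \<and> (\<forall>i\<in>B. q i = p i)} \<subseteq> {q. q permutes A - B}"
    proof clarify
      fix q assume q: "q permutes A" "\<forall>i\<in>B. q i = p i"
      have "inv p \<circ> q permutes A" using q(1) permutes_inv[OF assms(2)] by (rule permutes_compose)
      then show "inv p \<circ> q permutes A - B"
        by (rule permutes_superset) (use q(2) permutes_inverses(2)[OF assms(2)] in auto)
    qed
  qed
  from bij_betw_same_card[OF this]
  have "card {q. q permutes A \<and> (\<forall>i\<in>B. q i = p i)} = card {q. q permutes A - B}" by simp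
  also have "\<dots> = fact (card A - card B)"
    using assms by (intro card_permutations) (auto simp: card_Diff_subset finite_subset)
  finally show ?thesis .
qed

text \<open>Only an inequality, because \<open>Y\<close> may have two cells in a row or column and
  then lies in no permutation.\<close>

lemma card_permutations_containing_le:
  "card {\<pi>. \<pi> permutes {1..n} \<and> Y \<subseteq> perm_graph n \<pi>} \<le> fact (n - card Y)"
proof (cases "\<exists>p. p permutes {1..n} \<and> Y \<subseteq> perm_graph n p")
  case True
  then obtain p where p: "p permutes {1..n}" "Y \<subseteq> perm_graph n p" by blast
  have Y: "fst z \<in> {1..n} \<and> z = (fst z, \<pi> (fst z))" if "z \<in> Y" "Y \<subseteq> perm_graph n \<pi>" for z \<pi>
    using that unfolding perm_graph_def by auto
  have inj: "inj_on fst Y" using Y[OF _ p(2)] by (metis inj_onI)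
  have sub: "fst ` Y \<subseteq> {1..n}" using Y[OF _ p(2)] by blast
  have "{\<pi>. \<pi> permutes {1..n} \<and> Y \<subseteq> perm_graph n \<pi>} \<subseteq> {q. q permutes {1..n} \<and> (\<forall>i\<in>fst ` Y. q i = p i)}"
    using Y[OF _ p(2)] Y by (auto; metis prod.inject)
  then have "card {\<pi>. \<pi> permutes {1..n} \<and> Y \<subseteq> perm_graph n \<pi>} \<le> card {q. q permutes {1..n} \<and> (\<forall>i\<in>fst ` Y. q i = p i)}"
    by (intro card_mono finite_subset[OF _ finite_permutations[of "{1..n}"]]) auto
  also have "\<dots> = fact (n - card Y)"
    using card_permutations_agreeing[OF _ p(1) sub] card_image[OF inj] by simp
  finally show ?thesis .
next
  case False
  then have "{\<pi>. \<pi> permutes {1..n} \<and> Y \<subseteq> perm_graph n \<pi>} = {}" by auto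
  then show ?thesis by (metis card.empty le0)
qed

lemma card_derangements_at:
  assumes "x \<in> {1..n}" "y \<in> {1..n}" "x \<noteq> y"
  shows "card (derangements_at n x y) = d1 n"
proof -
  have n: "1 \<in> {1..n}" "2 \<in> {1..n}" using assms by auto
  \<comment> \<open>Conjugation by \<open>t\<close> needs \<open>1\<close> sent to \<open>x\<close>
    and \<open>2\<close> to \<open>y\<close>. The first transposition moves \<open>2\<close> when
    \<open>x = 2\<close>, so the second one starts from the image \<open>z\<close> of
    \<open>2\<close>.\<close>
  define z where "z = transpose 1 x 2"
  define t where "t = transpose z y \<circ> transpose 1 x"
  have z: "z \<in> {1..n}" "z \<noteq> x" using n assms unfolding z_def by (auto simp: transpose_def)
  have t: "t permutes {1..n}" unfolding t_def
    by (intro permutes_compose permutes_swap_id) (use n z assms in auto)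
  have t1: "t 1 = x" "t 2 = y" using z assms unfolding t_def z_def[symmetric] comp_def
    by (auto simp: transpose_def z_def)
  have ti: "inv t permutes {1..n}" using permutes_inv[OF t] .
  have i1: "inv t (t i) = i" "t (inv t i) = i" for i using permutes_inverses[OF t] by auto
  have invx: "inv t x = 1" "inv t y = 2" using i1 t1 by metis+
  have "bij_betw (\<lambda>p. t \<circ> p \<circ> inv t) (derangements_at n 1 2) (derangements_at n x y)"
  proof (rule bij_betw_byWitness[where f' = "\<lambda>p. inv t \<circ> p \<circ> t"])
    show "\<forall>p\<in>derangements_at n 1 2. inv t \<circ> (t \<circ> p \<circ> inv t) \<circ> t = p" by (simp add: fun_eq_iff i1)
    show "\<forall>p\<in>derangements_at n x y. t \<circ> (inv t \<circ> p \<circ> t) \<circ> inv t = p" by (simp add: fun_eq_iff i1)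
    show "(\<lambda>p. t \<circ> p \<circ> inv t) ` derangements_at n 1 2 \<subseteq> derangements_at n x y"
    proof clarify
      fix p assume p: "p \<in> derangements_at n 1 2"
      then have pp: "p permutes {1..n}" by (simp add: derangements_at_def derangements_def)
      have "t \<circ> p \<circ> inv t permutes {1..n}" by (intro permutes_compose ti t pp)
      moreover have "t (p (inv t i)) \<noteq> i" if "i \<in> {1..n}" for i
      proof
        assume "t (p (inv t i)) = i"
        then have "p (inv t i) = inv t i" using i1 by metis
        moreover have "inv t i \<in> {1..n}" using permutes_in_image[OF ti] that by blast
        ultimately show False using p unfolding derangements_at_def derangements_def by auto
      qed
      moreover have "p 1 = 2" using p by (simp add: derangements_at_def)
      ultimately show "t \<circ> p \<circ> inv t \<in> derangements_at n x y"
        by (simp add: derangements_at_def derangements_def invx t1)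
    qed
    show "(\<lambda>p. inv t \<circ> p \<circ> t) ` derangements_at n x y \<subseteq> derangements_at n 1 2"
    proof clarify
      fix p assume p: "p \<in> derangements_at n x y"
      then have pp: "p permutes {1..n}" by (simp add: derangements_at_def derangements_def)
      have "inv t \<circ> p \<circ> t permutes {1..n}" by (intro permutes_compose ti t pp)
      moreover have "inv t (p (t i)) \<noteq> i" if "i \<in> {1..n}" for i
      proof
        assume "inv t (p (t i)) = i"
        then have "p (t i) = t i" using i1 by metis
        moreover have "t i \<in> {1..n}" using permutes_in_image[OF t] that by blast
        ultimately show False using p unfolding derangements_at_def derangements_def by auto
      qed
      moreover have "p x = y" using p by (simp add: derangements_at_def)
      ultimately show "inv t \<circ> p \<circ> t \<in> derangements_at n 1 2"
        by (simp add: derangements_at_def derangements_def invx t1[simplified])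
    qed
  qed
  then show ?thesis unfolding d1_def by (metis bij_betw_same_card)
qed

section \<open>Permutations through a pair that avoid two values in every other row\<close>

locale two_forbidden =
  fixes n x y :: nat and \<sigma> :: "nat \<Rightarrow> nat"
  assumes n: "1000 \<le> n" and x: "x \<in> {1..n}" and y: "y \<in> {1..n}" and \<sigma>: "\<sigma> permutes {1..n}"
begin

definition \<Omega> :: "(nat \<Rightarrow> nat) set" where "\<Omega> = {\<pi>. \<pi> permutes {1..n} \<and> \<pi> x = y}"

text \<open>Row \<open>x\<close> is left out because its value is prescribed. With the identity as
  \<open>\<sigma>\<close> the hits are just the fixed points outside \<open>x\<close>.\<close>

definition hits :: "(nat \<Rightarrow> nat) \<Rightarrow> nat set" where
  "hits \<pi> = {i\<in>{1..n} - {x}. \<pi> i = i \<or> \<pi> i = \<sigma> i}"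

definition level :: "nat \<Rightarrow> (nat \<Rightarrow> nat) set" where "level j = {\<pi>\<in>\<Omega>. card (hits \<pi>) = j}"

lemma finite_\<Omega>: "finite \<Omega>"
  unfolding \<Omega>_def by (rule finite_subset[OF _ finite_permutations[of "{1..n}"]]) auto

lemma finite_hits [simp]: "finite (hits \<pi>)"
  unfolding hits_def by simp

lemma finite_level [simp]: "finite (level j)"
  unfolding level_def using finite_\<Omega> by simp

lemma card_\<Omega>: "card \<Omega> = fact (n - 1)"
proof -
  have "transpose x y permutes {1..n}" using x y by (rule permutes_swap_id)
  then have "card {q. q permutes {1..n} \<and> (\<forall>i\<in>{x}. q i = transpose x y i)} = fact (card {1..n} - card {x})"
    using x by (intro card_permutations_agreeing) auto
  then show ?thesis unfolding \<Omega>_def by simp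
qed

lemma sum_card_hits: "(\<Sum>\<pi>\<in>\<Omega>. card (hits \<pi>)) \<le> 2 * fact (n - 1)"
proof -
  have c: "card {\<pi>\<in>\<Omega>. \<pi> i = b} \<le> fact (n - 2)" if "i \<in> {1..n} - {x}" for i b
  proof -
    have "{\<pi>\<in>\<Omega>. \<pi> i = b} \<subseteq> {\<pi>. \<pi> permutes {1..n} \<and> {(x, y), (i, b)} \<subseteq> perm_graph n \<pi>}"
      using that x unfolding \<Omega>_def by auto
    then have "card {\<pi>\<in>\<Omega>. \<pi> i = b} \<le> card {\<pi>. \<pi> permutes {1..n} \<and> {(x, y), (i, b)} \<subseteq> perm_graph n \<pi>}"
      by (intro card_mono finite_subset[OF _ finite_permutations[of "{1..n}"]]) auto
    also have "\<dots> \<le> fact (n - card {(x, y), (i, b)})" by (rule card_permutations_containing_le)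
    also have "card {(x, y), (i, b)} = 2" using that by auto
    finally show ?thesis .
  qed
  have "(\<Sum>\<pi>\<in>\<Omega>. card (hits \<pi>)) = (\<Sum>\<pi>\<in>\<Omega>. \<Sum>i\<in>{1..n} - {x}. if \<pi> i = i \<or> \<pi> i = \<sigma> i then 1 else 0)"
    unfolding hits_def by (intro sum.cong refl) (simp add: sum.If_cases Int_def)
  also have "\<dots> = (\<Sum>i\<in>{1..n} - {x}. \<Sum>\<pi>\<in>\<Omega>. if \<pi> i = i \<or> \<pi> i = \<sigma> i then 1 else 0)"
    by (rule sum.swap)
  also have "\<dots> = (\<Sum>i\<in>{1..n} - {x}. card {\<pi>\<in>\<Omega>. \<pi> i = i \<or> \<pi> i = \<sigma> i})"
    using finite_\<Omega> by (intro sum.cong refl) (simp add: sum.If_cases Int_def)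
  also have "\<dots> \<le> (\<Sum>i\<in>{1..n} - {x}. 2 * fact (n - 2))"
  proof (rule sum_mono)
    fix i assume i: "i \<in> {1..n} - {x}"
    have "{\<pi>\<in>\<Omega>. \<pi> i = i \<or> \<pi> i = \<sigma> i} = {\<pi>\<in>\<Omega>. \<pi> i = i} \<union> {\<pi>\<in>\<Omega>. \<pi> i = \<sigma> i}" by auto
    then have "card {\<pi>\<in>\<Omega>. \<pi> i = i \<or> \<pi> i = \<sigma> i} \<le> card {\<pi>\<in>\<Omega>. \<pi> i = i} + card {\<pi>\<in>\<Omega>. \<pi> i = \<sigma> i}"
      by (simp only: card_Un_le)
    then show "card {\<pi>\<in>\<Omega>. \<pi> i = i \<or> \<pi> i = \<sigma> i} \<le> 2 * fact (n - 2)"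
      using c[OF i, of i] c[OF i, of "\<sigma> i"] by linarith
  qed
  also have "\<dots> = 2 * ((n - 1) * fact (n - 2))" using x by simp
  also have "(n - 1) * fact (n - 2) = fact (n - 1)"
  proof -
    have "n - 1 = Suc (n - 2)" using n by simp
    then show ?thesis by (metis fact_Suc of_nat_id)
  qed
  finally show ?thesis .
qed

text \<open>Double counting of the switchings that exchange the values at a hit \<open>i\<close> and at a non-hit \<open>l\<close>
  and thereby destroy exactly one hit.\<close>

lemma level_step:
  assumes j: "1 \<le> j" "j \<le> 2"
  shows "card (level j) * (j * (n - 7)) \<le> card (level (j - 1)) * ((n - 1) * 2)"
proof -
  \<comment> \<open>The last two conditions prevent the exchanged values from creating a hit at
    \<open>i\<close> or at \<open>l\<close>.\<close>
  define good where "good \<pi> i = {l\<in>{1..n} - {x}. l \<notin> hits \<pi> \<and> \<pi> l \<notin> {i, \<sigma> i} \<and> \<pi> i \<notin> {l, \<sigma> l}}" for \<pi> i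
  define E where "E = (SIGMA \<pi>:level j. SIGMA i:hits \<pi>. good \<pi> i)"
  \<comment> \<open>After the switching, position \<open>l\<close> carries the value that was a hit
    at \<open>i\<close>. Hence a given result and a given \<open>i\<close> leave only two candidates
    for \<open>l\<close>.\<close>
  define Q where "Q = (SIGMA \<pi>:level (j - 1). SIGMA i:{1..n} - {x}. {l\<in>{1..n}. \<pi> l \<in> {i, \<sigma> i}})"
  define f where "f = (\<lambda>(\<pi> :: nat \<Rightarrow> nat, i, l). (\<pi> \<circ> transpose i l, i, l :: nat))"
  have perm: "\<pi> permutes {1..n}" if "\<pi> \<in> level k" for \<pi> k using that unfolding level_def \<Omega>_def by auto
  have finE: "finite E" unfolding E_def by (intro finite_SigmaI) (auto simp: good_def)
  have finQ: "finite Q" unfolding Q_def by (intro finite_SigmaI) auto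
  have two: "card {l\<in>{1..n}. \<pi> l \<in> {a, b}} \<le> 2" if "\<pi> permutes {1..n}" for \<pi> a b
  proof -
    have "{l\<in>{1..n}. \<pi> l \<in> {a, b}} \<subseteq> {inv \<pi> a, inv \<pi> b}" using permutes_inverses(2)[OF that] by auto
    then have "card {l\<in>{1..n}. \<pi> l \<in> {a, b}} \<le> card {inv \<pi> a, inv \<pi> b}" by (intro card_mono) auto
    also have "\<dots> \<le> 2" by (simp add: card_insert_if)
    finally show ?thesis .
  qed
  \<comment> \<open>Of the \<open>n - 1\<close> rows at most six are lost: two hits, two rows with
    value in \<open>{i, \<sigma> i}\<close>, and the two rows \<open>\<pi> i\<close> and
    \<open>inv \<sigma> (\<pi> i)\<close>.\<close>
  have good: "n - 7 \<le> card (good \<pi> i)" if "\<pi> \<in> level j" for \<pi> i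
  proof -
    have sub: "{1..n} - {x} \<subseteq> good \<pi> i \<union> hits \<pi> \<union> {l\<in>{1..n}. \<pi> l \<in> {i, \<sigma> i}} \<union> {\<pi> i, inv \<sigma> (\<pi> i)}"
      unfolding good_def using permutes_inverses(2)[OF \<sigma>] by auto
    have "n - 1 = card ({1..n} - {x})" using x by simp
    also have "\<dots> \<le> card (good \<pi> i \<union> hits \<pi> \<union> {l\<in>{1..n}. \<pi> l \<in> {i, \<sigma> i}} \<union> {\<pi> i, inv \<sigma> (\<pi> i)})"
      by (rule card_mono[OF _ sub]) (auto simp: good_def)
    also have "\<dots> \<le> card (good \<pi> i) + card (hits \<pi>) + card {l\<in>{1..n}. \<pi> l \<in> {i, \<sigma> i}} + card {\<pi> i, inv \<sigma> (\<pi> i)}"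
      by (meson add_le_mono card_Un_le le_refl le_trans)
    also have "card (hits \<pi>) \<le> 2" using that j unfolding level_def by simp
    also have "card {l\<in>{1..n}. \<pi> l \<in> {i, \<sigma> i}} \<le> 2" using two[OF perm[OF that]] .
    also have "card {\<pi> i, inv \<sigma> (\<pi> i)} \<le> 2" by (simp add: card_insert_if)
    finally show ?thesis by simp
  qed
  have fQ: "f (\<pi>, i, l) \<in> Q" if "(\<pi>, i, l) \<in> E" for \<pi> i l
  proof -
    have \<pi>: "\<pi> \<in> level j" and i: "i \<in> hits \<pi>" and l: "l \<in> {1..n} - {x}" "l \<notin> hits \<pi>"
      "\<pi> l \<notin> {i, \<sigma> i}" "\<pi> i \<notin> {l, \<sigma> l}" using that unfolding E_def good_def by auto
    have ix: "i \<in> {1..n} - {x}" using i unfolding hits_def by auto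
    define \<pi>' where "\<pi>' = \<pi> \<circ> transpose i l"
    have "\<pi>' permutes {1..n}" unfolding \<pi>'_def
      by (intro permutes_compose permutes_swap_id perm[OF \<pi>]) (use ix l in auto)
    moreover have "\<pi>' x = y" using \<pi> ix l unfolding \<pi>'_def level_def \<Omega>_def by (auto simp: transpose_def)
    ultimately have "\<pi>' \<in> \<Omega>" unfolding \<Omega>_def by simp
    moreover have "hits \<pi>' = hits \<pi> - {i}"
      using l i unfolding hits_def \<pi>'_def by (auto simp: transpose_def)
    then have "card (hits \<pi>') = j - 1" using i \<pi> unfolding level_def by simp
    ultimately have "\<pi>' \<in> level (j - 1)" unfolding level_def by simp
    moreover have "\<pi>' l \<in> {i, \<sigma> i}" using i unfolding \<pi>'_def hits_def by auto
    ultimately show ?thesis using ix l unfolding f_def Q_def \<pi>'_def by simp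
  qed
  have "card (level j) * (j * (n - 7)) = (\<Sum>\<pi>\<in>level j. \<Sum>i\<in>hits \<pi>. n - 7)"
    unfolding level_def by simp
  also have "\<dots> \<le> (\<Sum>\<pi>\<in>level j. \<Sum>i\<in>hits \<pi>. card (good \<pi> i))"
    by (intro sum_mono good)
  also have "\<dots> = card E"
    unfolding E_def by (simp add: card_SigmaI good_def)
  also have "\<dots> = card (f ` E)"
  proof (rule card_image[symmetric], rule inj_onI)
    fix p q assume "f p = f q"
    then show "p = q" unfolding f_def
      by (auto simp: split_beta prod_eq_iff fun_eq_iff) (metis transpose_involutory)
  qed
  also have "\<dots> \<le> card Q"
    by (rule card_mono[OF finQ]) (use fQ in auto)
  also have "\<dots> = (\<Sum>\<pi>\<in>level (j - 1). \<Sum>i\<in>{1..n} - {x}. card {l\<in>{1..n}. \<pi> l \<in> {i, \<sigma> i}})"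
    unfolding Q_def by (simp add: card_SigmaI)
  also have "\<dots> \<le> (\<Sum>\<pi>\<in>level (j - 1). \<Sum>i\<in>{1..n} - {x}. 2)"
    by (intro sum_mono two perm)
  also have "\<dots> = card (level (j - 1)) * ((n - 1) * 2)" using x by simp
  finally show ?thesis .
qed

text \<open>The average number of hits is at most 2, so at least a third of \<open>\<Omega>\<close>
  has at most two hits. As \<open>n - 1 \<le> 101 / 100 * (n - 7)\<close>, levels 1 and 2 have at
  most 2.02 and \<open>1.01 * 2.02\<close> times the size of level 0. Finally
  \<open>3 * (1 + 2.02 + 1.01 * 2.02)\<close> is below 16.\<close>

lemma card_level_0: "fact (n - 1) \<le> 16 * real (card (level 0))"
proof -
  define m where "m = real n - 7"
  have m: "0 < m" "real (n - 7) = m" "real (n - 1) \<le> 101 / 100 * m" using n unfolding m_def by (auto simp: of_nat_diff)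
  have "card (level 1) * (n - 7) \<le> card (level 0) * 2 * (n - 1)" using level_step[of 1] by simp
  from of_nat_mono[OF this, where 'a = real]
  have "real (card (level 1)) * m \<le> real (card (level 0)) * 2 * real (n - 1)"
    by (simp only: of_nat_mult of_nat_numeral m(2))
  also have "\<dots> \<le> real (card (level 0)) * 2 * (101 / 100 * m)" using m by (intro mult_left_mono) auto
  finally have "real (card (level 1)) * m \<le> (202 / 100 * real (card (level 0))) * m" by (simp add: mult_ac)
  then have l1: "real (card (level 1)) \<le> 202 / 100 * real (card (level 0))"
    using m(1) by (metis mult_le_cancel_right_pos)
  have "card (level 2) * (n - 7) \<le> card (level 1) * (n - 1)" using level_step[of 2] by simp
  from of_nat_mono[OF this, where 'a = real]
  have "real (card (level 2)) * m \<le> real (card (level 1)) * real (n - 1)"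
    by (simp only: of_nat_mult m(2))
  also have "\<dots> \<le> real (card (level 1)) * (101 / 100 * m)" using m by (intro mult_left_mono) auto
  finally have "real (card (level 2)) * m \<le> (101 / 100 * real (card (level 1))) * m" by (simp add: mult_ac)
  then have l2: "real (card (level 2)) \<le> 101 / 100 * real (card (level 1))"
    using m(1) by (metis mult_le_cancel_right_pos)
  define big where "big = {\<pi>\<in>\<Omega>. 3 \<le> card (hits \<pi>)}"
  have "3 * card big = (\<Sum>\<pi>\<in>big. 3)" by simp
  also have "\<dots> \<le> (\<Sum>\<pi>\<in>big. card (hits \<pi>))" by (intro sum_mono) (auto simp: big_def)
  also have "\<dots> \<le> (\<Sum>\<pi>\<in>\<Omega>. card (hits \<pi>))"
    by (intro sum_mono2 finite_\<Omega>) (auto simp: big_def)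
  also note sum_card_hits
  finally have "real (3 * card big) \<le> real (2 * fact (n - 1))" by (rule of_nat_mono)
  then have b: "3 * real (card big) \<le> 2 * fact (n - 1)" by simp
  have "card (hits \<pi>) = 0 \<or> card (hits \<pi>) = 1 \<or> card (hits \<pi>) = 2 \<or> 3 \<le> card (hits \<pi>)" for \<pi>
    by linarith
  then have "\<Omega> \<subseteq> level 0 \<union> level 1 \<union> level 2 \<union> big" unfolding level_def big_def by blast
  then have "card \<Omega> \<le> card (level 0 \<union> level 1 \<union> level 2 \<union> big)"
    using finite_\<Omega> by (intro card_mono) (auto simp: big_def)
  also have "\<dots> \<le> card (level 0) + card (level 1) + card (level 2) + card big"
    by (meson add_le_mono card_Un_le le_refl le_trans)
  finally have "real (fact (n - 1)) \<le> real (card (level 0) + card (level 1) + card (level 2) + card big)"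
    unfolding card_\<Omega> by (rule of_nat_mono)
  then have "fact (n - 1) \<le> real (card (level 0)) + real (card (level 1)) + real (card (level 2)) + real (card big)"
    by simp
  then show ?thesis using b l1 l2 by linarith
qed

end

lemma card_avoiding_ge:
  assumes "1000 \<le> n" "x \<in> {1..n}" "y \<in> {1..n}" "\<sigma> permutes {1..n}"
  shows "fact (n - 1) \<le> 16 * real (card {\<pi>. \<pi> permutes {1..n} \<and> \<pi> x = y \<and>
    (\<forall>i\<in>{1..n} - {x}. \<pi> i \<noteq> i \<and> \<pi> i \<noteq> \<sigma> i)})"
proof -
  interpret two_forbidden n x y \<sigma> using assms by unfold_locales
  have "level 0 = {\<pi>. \<pi> permutes {1..n} \<and> \<pi> x = y \<and> (\<forall>i\<in>{1..n} - {x}. \<pi> i \<noteq> i \<and> \<pi> i \<noteq> \<sigma> i)}"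
    unfolding level_def \<Omega>_def by (auto simp: hits_def)
  then show ?thesis using card_level_0 by simp
qed

lemma fact_le_d1:
  assumes "1000 \<le> n"
  shows "fact (n - 1) \<le> 16 * real (d1 n)"
proof -
  have "{\<pi>. \<pi> permutes {1..n} \<and> \<pi> 1 = 2 \<and> (\<forall>i\<in>{1..n} - {1}. \<pi> i \<noteq> i \<and> \<pi> i \<noteq> id i)} = derangements_at n 1 2"
    unfolding derangements_at_def derangements_def by force
  then show ?thesis using card_avoiding_ge[OF assms, of 1 2 id] assms
    unfolding d1_def by (simp add: permutes_id)
qed

text \<open>Start from a derangement \<open>p\<close> with \<open>p x = y\<close> and let
  \<open>a\<close> be the place of the value \<open>y'\<close>. Swapping the values at
  \<open>x'\<close> and \<open>a\<close> could create a fixed point at \<open>a\<close>, so the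
  values at \<open>x'\<close>, \<open>a\<close> and a third place \<open>l\<close> are rotated;
  \<open>l\<close> is chosen to avoid the few places that would produce a fixed point or disturb
  \<open>x\<close>. The lemma shows that stars centred in different rows and columns
  overlap.\<close>

lemma derangement_through_two_pairs:
  assumes n: "1000 \<le> n" and x: "x \<in> {1..n}" "x' \<in> {1..n}" and y: "y \<in> {1..n}" "y' \<in> {1..n}"
    and ne: "x \<noteq> y" "x' \<noteq> y'" "x \<noteq> x'" "y \<noteq> y'"
  shows "derangements_at n x y \<inter> derangements_at n x' y' \<noteq> {}"
proof -
  have "0 < real (d1 n)" using fact_le_d1[OF n] fact_gt_zero[of "n - 1", where 'a = real] by linarith
  then have "card (derangements_at n x y) \<noteq> 0" using card_derangements_at[OF x(1) y(1) ne(1)] by simp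
  then obtain p where "p \<in> derangements_at n x y" by fastforce
  then have p: "p permutes {1..n}" and fpf: "\<And>i. i \<in> {1..n} \<Longrightarrow> p i \<noteq> i" and px: "p x = y"
    unfolding derangements_at_def derangements_def by auto
  have inj: "p i = p j \<longleftrightarrow> i = j" for i j using permutes_inj[OF p] by (auto simp: inj_def)
  define a where "a = inv p y'"
  have pa: "p a = y'" unfolding a_def using permutes_inverses(1)[OF p] .
  have a: "a \<in> {1..n}" "a \<noteq> x" using permutes_in_image[OF p] pa y px ne by metis+
  show ?thesis
  proof (cases "a = x'")
    case True
    then show ?thesis using p fpf px pa unfolding derangements_at_def derangements_def by auto
  next
    case False
    have "card {x, x', a, p x', inv p a} < card {1..n}"
      using n by (intro le_less_trans[OF card_insert_le_m1[of 5]]) (auto simp: card_insert_if)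
    then obtain l where l: "l \<in> {1..n}" "l \<notin> {x, x', a, p x', inv p a}"
      by (metis card_mono finite.emptyI finite_insert not_le subsetI)
    have pl: "p l \<noteq> a" using l permutes_inverses(2)[OF p] by auto
    define t where "t = transpose x' a \<circ> transpose a l"
    have t: "t x' = a" "t a = l" "t l = x'" "\<And>i. i \<noteq> x' \<Longrightarrow> i \<noteq> a \<Longrightarrow> i \<noteq> l \<Longrightarrow> t i = i"
      using l False unfolding t_def by (auto simp: transpose_def)
    have "p \<circ> t permutes {1..n}" unfolding t_def
      by (intro permutes_compose permutes_swap_id p) (use a l x in auto)
    moreover have "p (t i) \<noteq> i" if "i \<in> {1..n}" for i
    proof -
      consider "i = x'" | "i = a" | "i = l" | "i \<noteq> x'" "i \<noteq> a" "i \<noteq> l" by blast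
      then show ?thesis
      proof cases
        case 1 then show ?thesis using t(1) pa ne(2) by metis
      next
        case 2 then show ?thesis using t(2) pl by metis
      next
        case 3 then show ?thesis using t(3) l(2) by (metis insert_iff)
      next
        case 4 then show ?thesis using t(4) fpf[OF that] by metis
      qed
    qed
    moreover have "p (t x) = y" "p (t x') = y'"
      using t(1) t(4)[of x] px pa a(2) ne(3) l(2) by auto
    ultimately have "p \<circ> t \<in> derangements_at n x y \<inter> derangements_at n x' y'"
      unfolding derangements_at_def derangements_def by simp
    then show ?thesis by blast
  qed
qed

section \<open>Families of derangements\<close>

lemma card_le_nu:
  assumes "finite F" "M \<subseteq> F" "\<And>\<sigma> \<tau>. \<sigma> \<in> M \<Longrightarrow> \<tau> \<in> M \<Longrightarrow> \<sigma> \<noteq> \<tau> \<Longrightarrow> \<not> perm_intersect n \<sigma> \<tau>"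
  shows "card M \<le> nu n F"
  unfolding nu_def
proof (rule Max_ge)
  show "finite {card M | M. M \<subseteq> F \<and> (\<forall>\<sigma>\<in>M. \<forall>\<tau>\<in>M. \<sigma> \<noteq> \<tau> \<longrightarrow> \<not> perm_intersect n \<sigma> \<tau>)}"
    by (rule finite_subset[of _ "card ` Pow F"]) (use assms(1) in auto)
qed (use assms in auto)

text \<open>The factor 4 in \<open>b\<close> serves two purposes:
  \<open>(3 / 5) ^ b \<le> exp (- b / 2) \<le> 1 / n ^ 2\<close> beats the union bound, and
  \<open>n ^ 4 \<le> 100 ^ b\<close> makes the remainder of the core decomposition negligible. The
  lower bound on \<open>n\<close> is forced by \<open>s \<ge> 1\<close>.\<close>

lemma parameter_estimates:
  fixes n s :: nat
  defines "b \<equiv> nat \<lceil>4 * ln (real n)\<rceil>"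
  assumes s: "1 \<le> s" and hs: "real s \<le> real n / (2 ^ 17 * ln (real n))"
  shows "1000 \<le> n" "0 < b" "30000 * (real s * real b) \<le> real (n - 1)"
    "real s * ((3 / 5) ^ b * real n) < 1" "real n ^ 4 \<le> 100 ^ b"
proof -
  define l where "l = ln (real n)"
  \<comment> \<open>For \<open>n = 1\<close> the denominator is 0 and the quotient is 0 by
    convention; for \<open>n = 0\<close> the numerator vanishes.\<close>
  have "n \<noteq> 0" "n \<noteq> 1" using s hs by (intro notI; simp)+
  then have n2: "2 \<le> n" by simp
  have "ln (1 / real n) \<le> 1 / real n - 1" using n2 by (intro ln_le_minus_one) auto
  moreover have "1 / real n \<le> 1 / 2" using n2 by (simp add: field_simps)
  moreover have "ln (1 / real n) = - l" using n2 unfolding l_def by (simp add: ln_div)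
  ultimately have l2: "1 / 2 \<le> l" by linarith
  have sl: "real s * (131072 * l) \<le> real n"
    using hs l2 unfolding l_def by (simp add: pos_le_divide_eq)
  have "1 * (131072 * (1 / 2)) \<le> real s * (131072 * l)"
    using s l2 by (intro mult_mono) auto
  then have n: "65536 \<le> real n" using sl by linarith
  then show n1000: "1000 \<le> n" by simp
  \<comment> \<open>\<open>3 ^ 10 = 59049\<close> is below \<open>65536\<close>. Thus
    \<open>l\<close> is at least 10, and rounding up in \<open>b\<close> costs at most
    \<open>l / 10\<close>.\<close>
  have "exp (10 :: real) = exp 1 ^ 10" by (simp flip: exp_of_nat_mult)
  also have "\<dots> \<le> 3 ^ 10" by (intro power_mono exp_le) auto
  also have "\<dots> \<le> real n" using n by simp
  finally have "exp 10 \<le> real n" .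
  then have l10: "10 \<le> l" unfolding l_def using n by (subst ln_ge_iff) auto
  have b1: "4 * l \<le> real b" unfolding b_def l_def by linarith
  have b2: "real b \<le> 41 / 10 * l" using l10 unfolding b_def l_def by linarith
  show "0 < b" using b1 l10 by simp
  have "30000 * (real s * real b) \<le> 30000 * (real s * (41 / 10 * l))"
    using b2 by (intro mult_left_mono) auto
  also have "\<dots> = 123000 / 131072 * (real s * (131072 * l))" by simp
  also have "\<dots> \<le> 123000 / 131072 * real n" using sl by (intro mult_left_mono) auto
  also have "\<dots> \<le> real n - 1" using n by simp
  also have "\<dots> = real (n - 1)" using n2 by (simp add: of_nat_diff)
  finally show "30000 * (real s * real b) \<le> real (n - 1)" .
  have en: "exp l = real n" unfolding l_def using n by simp
  \<comment> \<open>The quadratic bound applied directly at \<open>1 / 2\<close> gives only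
    \<open>7 / 4\<close>, which exceeds \<open>5 / 3\<close>; applied at \<open>1 / 32\<close> and
    raised to the 16th power it suffices.\<close>
  have "exp (1 / 2 :: real) = exp (1 / 32) ^ 16" by (simp flip: exp_of_nat_mult)
  also have "\<dots> \<le> (1 + 1 / 32 + (1 / 32) ^ 2) ^ 16" by (intro power_mono exp_bound) auto
  also have "\<dots> \<le> 5 / 3" by (simp add: power2_eq_square power_divide)
  finally have "exp (1 / 2 :: real) \<le> 5 / 3" .
  then have "3 / 5 \<le> exp (- (1 / 2) :: real)" by (simp add: exp_minus field_simps)
  then have "(3 / 5) ^ b \<le> exp (- (1 / 2) :: real) ^ b" by (intro power_mono) auto
  also have "\<dots> = exp (- (real b / 2))" by (simp flip: exp_of_nat_mult)
  also have "\<dots> \<le> exp (- (l + l))" using b1 by simp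
  also have "\<dots> = 1 / (real n * real n)" by (simp only: exp_minus exp_add en) (simp add: field_simps)
  finally have p: "(3 / 5) ^ b \<le> 1 / (real n * real n)" .
  have "(3 / 5) ^ b * real n \<le> 1 / (real n * real n) * real n" using p by (intro mult_right_mono) auto
  then have "(3 / 5) ^ b * real n \<le> 1 / real n" using n by simp
  then have "real s * ((3 / 5) ^ b * real n) \<le> real s * (1 / real n)" by (intro mult_left_mono) auto
  also have "\<dots> < 1"
  proof -
    have "real s * (131072 * 1) \<le> real s * (131072 * l)" using l10 by (intro mult_left_mono) auto
    then have "real s < real n" using sl s by linarith
    then show ?thesis using n by simp
  qed
  finally show "real s * ((3 / 5) ^ b * real n) < 1" .
  have "real n ^ 4 = exp (4 * l)" unfolding en[symmetric] by (simp flip: exp_of_nat_mult)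
  also have "\<dots> \<le> exp (real b)" using b1 by simp
  also have "\<dots> = exp 1 ^ b" by (simp flip: exp_of_nat_mult)
  also have "\<dots> \<le> 100 ^ b" using exp_le by (intro power_mono) auto
  finally show "real n ^ 4 \<le> 100 ^ b" .
qed

section \<open>The structure of large families of derangements without \<open>s\<close> disjoint
  members\<close>

locale derangement_family =
  fixes n s b :: nat and F :: "(nat \<Rightarrow> nat) set"
  assumes n: "1000 \<le> n" and s: "0 < s" and b: "0 < b"
    and sb: "30000 * (real s * real b) \<le> real (n - 1)"
    and small: "real s * ((3 / 5) ^ b * real n) < 1" and n4: "real n ^ 4 \<le> 100 ^ b"
    and FD: "F \<subseteq> derangements n" and nuF: "nu n F < s"
begin

abbreviation G :: "(nat \<Rightarrow> nat) \<Rightarrow> (nat \<times> nat) set" where "G \<equiv> perm_graph n"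
abbreviation X :: "(nat \<times> nat) set" where "X \<equiv> {1..n} \<times> {1..n}"
abbreviation D :: real where "D \<equiv> real (d1 n)"

definition star :: "nat \<times> nat \<Rightarrow> (nat \<Rightarrow> nat) set" where "star p = {\<pi>\<in>F. p \<in> G \<pi>}"

lemma F_permutes: "\<pi> \<in> F \<Longrightarrow> \<pi> permutes {1..n}"
  using FD unfolding derangements_def by auto

lemma finite_permutes: "finite {\<pi>. \<pi> permutes {1..n} \<and> P \<pi>}"
  by (rule finite_subset[OF _ finite_permutations[of "{1..n}"]]) auto

lemma finite_derangements_at: "finite (derangements_at n x y)"
  by (rule finite_subset[OF _ finite_permutations[of "{1..n}"]])
    (auto simp: derangements_at_def derangements_def)

lemma finite_F: "finite F"
  by (rule finite_subset[OF _ finite_permutations[of "{1..n}"]]) (use F_permutes in blast, simp)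

lemma finite_star: "finite (star p)"
  unfolding star_def using finite_F by simp

lemma inj_G: "inj_on G {\<pi>. \<pi> permutes {1..n}}"
  by (rule inj_on_perm_graph)

lemma inj_G_F: "inj_on G F"
  by (rule inj_on_subset[OF inj_G]) (use F_permutes in blast)

lemma D_ge: "fact (n - 1) \<le> 16 * D"
  by (rule fact_le_d1[OF n])

lemma D_pos: "0 < D"
  using D_ge fact_gt_zero[of "n - 1", where 'a = real] by linarith

lemma D_le: "D \<le> fact (n - 1)"
proof -
  have "d1 n \<le> card {\<pi>. \<pi> permutes {1..n} \<and> {(1, 2)} \<subseteq> G \<pi>}"
    unfolding d1_def derangements_at_def derangements_def
    using n by (intro card_mono finite_permutes) auto
  also have "\<dots> \<le> fact (n - card {(1 :: nat, 2 :: nat)})" by (rule card_permutations_containing_le)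
  finally have "d1 n \<le> fact (n - 1)" by simp
  then have "D \<le> real (fact (n - 1))" by (rule of_nat_mono)
  then show ?thesis by simp
qed

lemma star_subset: "star p \<subseteq> derangements_at n (fst p) (snd p)"
  using FD unfolding star_def derangements_at_def by (cases p) auto

lemma star_off_diagonal: "\<pi> \<in> star p \<Longrightarrow> fst p \<in> {1..n} \<and> snd p \<in> {1..n} \<and> fst p \<noteq> snd p"
proof -
  assume a: "\<pi> \<in> star p"
  then have \<pi>: "\<pi> permutes {1..n}" "\<forall>i\<in>{1..n}. \<pi> i \<noteq> i" using FD unfolding star_def derangements_def by auto
  have p: "fst p \<in> {1..n}" "\<pi> (fst p) = snd p" using a unfolding star_def by (cases p; auto)+
  then have "snd p \<in> {1..n}" using permutes_in_image[OF \<pi>(1), of "fst p"] by simp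
  then show ?thesis using p \<pi>(2) by metis
qed

lemma card_star_le: "card (star p) \<le> d1 n"
proof (cases "star p = {}")
  case False
  then obtain \<pi> where "\<pi> \<in> star p" by blast
  then show ?thesis
    using card_mono[OF finite_derangements_at star_subset] card_derangements_at star_off_diagonal by metis
qed simp

lemma matching_less:
  assumes "M \<subseteq> F" "\<And>\<sigma> \<tau>. \<sigma> \<in> M \<Longrightarrow> \<tau> \<in> M \<Longrightarrow> \<sigma> \<noteq> \<tau> \<Longrightarrow> G \<sigma> \<inter> G \<tau> = {}"
  shows "card M < s"
proof -
  have "card M \<le> nu n F"
    by (rule card_le_nu[OF finite_F assms(1)]) (simp add: perm_intersect_iff assms(2))
  then show ?thesis using nuF by simp
qed

text \<open>The degree hypothesis is checked on all permutations containing \<open>Y\<close>, and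
  the factor 16 pays for comparing \<open>(n - 1)!\<close> with \<open>D\<close>. The remainder is
  at most \<open>D / 64\<close> because
  \<open>1024 * n ^ 2 \<le> n ^ 4 \<le> 100 ^ b\<close>.\<close>

lemma core_stars:
  "\<exists>H\<subseteq>X. card H < s \<and>
    real (card {\<pi>\<in>F. G \<pi> \<inter> H = {}}) \<le> real (s - 1 - card H) * (D / 2) + D / 64"
proof -
  have "\<exists>H\<subseteq>X. card H < s \<and> real (card {S\<in>G ` F. S \<inter> H = {}})
      \<le> real (s - 1 - card H) * (D / 2) + real (card X) * (16 * D / 100 ^ b)"
  proof (rule star_structure[where k = n])
    show "G ` F \<subseteq> Pow X" using perm_graph_subset F_permutes by blast
    have "G \<pi> \<noteq> {}" for \<pi> using card_perm_graph[of n \<pi>] n by (metis card.empty not_numeral_le_zero)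
    then show "{} \<notin> G ` F" by (metis imageE)
    show "card M < s" if M: "M \<subseteq> G ` F" "pairwise disjnt M" for M
    proof -
      obtain N where N: "N \<subseteq> F" "M = G ` N" using M(1) by (meson subset_image_iff)
      have "card N < s"
      proof (rule matching_less[OF N(1)])
        fix \<sigma> \<tau> assume "\<sigma> \<in> N" "\<tau> \<in> N" "\<sigma> \<noteq> \<tau>"
        then have "G \<sigma> \<noteq> G \<tau>" using inj_G_F N(1) unfolding inj_on_def by blast
        then show "G \<sigma> \<inter> G \<tau> = {}"
          using M(2) N(2) \<open>\<sigma> \<in> N\<close> \<open>\<tau> \<in> N\<close> unfolding pairwise_def disjnt_def by blast
      qed
      moreover have "card M = card N" unfolding N(2) by (intro card_image inj_on_subset[OF inj_G_F] N(1))
      ultimately show ?thesis by simp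
    qed
    fix Y assume Y: "Y \<subseteq> X" "Y \<noteq> {}"
    define j where "j = card Y - 1"
    have finY: "finite Y" using Y(1) by (rule finite_subset) simp
    have cY: "card Y = Suc j" using Y finY unfolding j_def by (simp add: card_gt_0_iff)
    show "real (card {S\<in>G ` F. Y \<subseteq> S}) * (100 * (real s * real b)) ^ (card Y - 1)
        \<le> 16 * D / 100 ^ (card Y - 1)"
    proof (cases "j \<le> n - 1")
      case False
      have "{S\<in>G ` F. Y \<subseteq> S} = {}"
      proof -
        have "card Y \<le> n" if "Y \<subseteq> G \<pi>" for \<pi>
          using card_mono[OF _ that] card_perm_graph[of n \<pi>] by (simp add: perm_graph_def)
        then show ?thesis using False cY by fastforce
      qed
      then have "real (card {S\<in>G ` F. Y \<subseteq> S}) = 0" by (simp only: card.empty of_nat_0)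
      then show ?thesis by simp
    next
      case True
      have "{S\<in>G ` F. Y \<subseteq> S} \<subseteq> G ` {\<pi>. \<pi> permutes {1..n} \<and> Y \<subseteq> G \<pi>}"
        using F_permutes by auto
      then have "card {S\<in>G ` F. Y \<subseteq> S} \<le> card {\<pi>. \<pi> permutes {1..n} \<and> Y \<subseteq> G \<pi>}"
        by (intro surj_card_le finite_permutes)
      also have "\<dots> \<le> fact (n - card Y)" by (rule card_permutations_containing_le)
      also have "n - card Y = n - 1 - j" using cY by simp
      finally have "real (card {S\<in>G ` F. Y \<subseteq> S}) \<le> real (fact (n - 1 - j))" by (rule of_nat_mono)
      then have c: "real (card {S\<in>G ` F. Y \<subseteq> S}) \<le> fact (n - 1 - j)" by simp
      \<comment> \<open>The 300 contained in \<open>sb\<close> splits into 3 for the falling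
        factorial and 100 for the decay.\<close>
      have "(100 * (real s * real b)) ^ j \<le> (real (n - 1) / 3 / 100) ^ j"
        using sb by (intro power_mono) auto
      also have "\<dots> = (real (n - 1) / 3) ^ j / 100 ^ j" by (rule power_divide)
      finally have "real (card {S\<in>G ` F. Y \<subseteq> S}) * (100 * (real s * real b)) ^ j
          \<le> fact (n - 1 - j) * ((real (n - 1) / 3) ^ j / 100 ^ j)"
        using c by (intro mult_mono) auto
      also have "\<dots> = fact (n - 1 - j) * (real (n - 1) / 3) ^ j / 100 ^ j" by simp
      also have "\<dots> \<le> fact (n - 1) / 100 ^ j"
        using fact_diff_mult_power_le[OF True] by (intro divide_right_mono) auto
      also have "\<dots> \<le> 16 * D / 100 ^ j" using D_ge by (intro divide_right_mono) auto
      finally show ?thesis unfolding j_def .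
    qed
  qed (use s b small in \<open>auto simp: card_perm_graph\<close>)
  then obtain H where H: "H \<subseteq> X" "card H < s" and
    le: "real (card {S\<in>G ` F. S \<inter> H = {}})
      \<le> real (s - 1 - card H) * (D / 2) + real (card X) * (16 * D / 100 ^ b)" by blast
  have "{S\<in>G ` F. S \<inter> H = {}} = G ` {\<pi>\<in>F. G \<pi> \<inter> H = {}}" by auto
  then have c: "card {S\<in>G ` F. S \<inter> H = {}} = card {\<pi>\<in>F. G \<pi> \<inter> H = {}}"
    by (metis (no_types, lifting) card_image inj_G_F inj_on_subset mem_Collect_eq subsetI)
  have "real (card X) * (16 * D / 100 ^ b) \<le> D / 64"
  proof -
    have "real (card X) * 1024 \<le> real n ^ 2 * real n ^ 2"
    proof -
      have "real 1000 ^ 2 \<le> real n ^ 2" using n by (intro power_mono of_nat_mono) auto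
      then have "real n ^ 2 * 1024 \<le> real n ^ 2 * real n ^ 2" by (intro mult_left_mono) auto
      then show ?thesis by (simp add: card_cartesian_product power2_eq_square)
    qed
    also have "\<dots> = real n ^ 4" by (simp flip: power_add)
    also have "\<dots> \<le> 100 ^ b" by (rule n4)
    finally have "D * (real (card X) * 1024) \<le> D * 100 ^ b" using D_pos by (intro mult_left_mono) auto
    then show ?thesis by (simp add: field_simps)
  qed
  then have "real (card {\<pi>\<in>F. G \<pi> \<inter> H = {}}) \<le> real (s - 1 - card H) * (D / 2) + D / 64"
    using le unfolding c by linarith
  then show ?thesis using H by blast
qed

lemma stars_cover: "F = {\<pi>\<in>F. G \<pi> \<inter> H = {}} \<union> (\<Union>p\<in>H. star p)"
  unfolding star_def by auto

text \<open>If the stars are almost full, then inside each of them a constant proportion of all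
  permutations through its centre avoids a given extra \<open>\<sigma>\<close> and the other centres; these
  subfamilies are spread, so together with \<open>\<sigma>\<close> they would yield a matching of size \<open>s\<close>.\<close>

lemma all_in_stars:
  assumes HX: "H \<subseteq> X" and cH: "card H = s - 1"
    and full: "\<And>p. p \<in> H \<Longrightarrow> 63 / 64 * D \<le> real (card (star p))"
  shows "F = (\<Union>p\<in>H. star p)"
proof (rule ccontr)
  assume "F \<noteq> (\<Union>p\<in>H. star p)"
  then obtain \<sigma> where \<sigma>F: "\<sigma> \<in> F" and \<sigma>H: "G \<sigma> \<inter> H = {}" using stars_cover[of H] by blast
  have \<sigma>: "\<sigma> permutes {1..n}" using F_permutes \<sigma>F .
  have finH: "finite H" using HX by (rule finite_subset) simp
  define K where "K p = {\<pi>\<in>star p. G \<pi> \<inter> G \<sigma> = {} \<and> G \<pi> \<inter> (H - {p}) = {}}" for p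
  define A where "A p = (\<lambda>\<pi>. G \<pi> - {p}) ` K p" for p
  have off: "fst p \<in> {1..n} \<and> snd p \<in> {1..n} \<and> fst p \<noteq> snd p" if "p \<in> H" for p
  proof -
    have "0 < real (card (star p))" using full[OF that] D_pos by linarith
    then have "star p \<noteq> {}" by auto
    then show ?thesis using star_off_diagonal by blast
  qed
  \<comment> \<open>At least \<open>(n - 1)! / 16\<close> permutations through \<open>p\<close>
    avoid the diagonal and \<open>\<sigma>\<close>. At most \<open>D / 64\<close> of them are
    missing from the star and at most \<open>s * (n - 2)!\<close> meet another centre. Both losses
    are at most \<open>(n - 1)! / 64\<close>, which leaves \<open>1 / 32\<close>.\<close>
  have cK: "fact (n - 1) \<le> 32 * real (card (K p))" if p: "p \<in> H" for p
  proof -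
    define av where "av = {\<pi>. \<pi> permutes {1..n} \<and> \<pi> (fst p) = snd p \<and>
      (\<forall>i\<in>{1..n} - {fst p}. \<pi> i \<noteq> i \<and> \<pi> i \<noteq> \<sigma> i)}"
    define hit where "hit q = {\<pi>. \<pi> permutes {1..n} \<and> {p, q} \<subseteq> G \<pi>}" for q
    have av: "fact (n - 1) \<le> 16 * real (card av)" unfolding av_def
      using off[OF p] \<sigma> by (intro card_avoiding_ge n) auto
    have "p \<notin> G \<sigma>" using \<sigma>H p by auto
    then have \<sigma>p: "\<sigma> (fst p) \<noteq> snd p" using off[OF p] by (cases p) auto
    have avD: "av \<subseteq> derangements_at n (fst p) (snd p)"
      unfolding av_def derangements_at_def derangements_def using off[OF p] by auto
    have avG: "G \<pi> \<inter> G \<sigma> = {}" if "\<pi> \<in> av" for \<pi>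
      using that \<sigma>p unfolding av_def perm_graph_def by force
    have "card (derangements_at n (fst p) (snd p) - star p) = card (derangements_at n (fst p) (snd p)) - card (star p)"
      by (rule card_Diff_subset[OF finite_star star_subset])
    also have "\<dots> = d1 n - card (star p)" using card_derangements_at off[OF p] by metis
    finally have lost: "real (card (derangements_at n (fst p) (snd p) - star p)) \<le> D / 64"
      using full[OF p] by linarith
    have "av \<subseteq> K p \<union> (derangements_at n (fst p) (snd p) - star p) \<union> (\<Union>q\<in>H - {p}. hit q)"
    proof
      fix \<pi> assume \<pi>: "\<pi> \<in> av"
      show "\<pi> \<in> K p \<union> (derangements_at n (fst p) (snd p) - star p) \<union> (\<Union>q\<in>H - {p}. hit q)"
      proof (cases "\<pi> \<in> star p \<and> G \<pi> \<inter> (H - {p}) \<noteq> {}")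
        case True
        then obtain q where "q \<in> H - {p}" "q \<in> G \<pi>" by blast
        moreover have "p \<in> G \<pi>" "\<pi> permutes {1..n}" using True F_permutes unfolding star_def by auto
        ultimately show ?thesis unfolding hit_def by auto
      next
        case False
        then show ?thesis using \<pi> avD avG[OF \<pi>] unfolding K_def by auto
      qed
    qed
    moreover have "finite (K p)" unfolding K_def using finite_star by simp
    moreover have finhit: "finite (hit q)" for q unfolding hit_def by (rule finite_permutes)
    ultimately have "card av \<le> card (K p \<union> (derangements_at n (fst p) (snd p) - star p) \<union> (\<Union>q\<in>H - {p}. hit q))"
      using finH finite_derangements_at by (intro card_mono) auto
    also have "\<dots> \<le> card (K p) + card (derangements_at n (fst p) (snd p) - star p) + card (\<Union>q\<in>H - {p}. hit q)"
      by (meson add_le_mono card_Un_le le_refl le_trans)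
    also have "card (\<Union>q\<in>H - {p}. hit q) \<le> (\<Sum>q\<in>H - {p}. card (hit q))"
      using finH by (intro card_UN_le) auto
    also have "\<dots> \<le> (\<Sum>q\<in>H - {p}. fact (n - 2))"
    proof (rule sum_mono)
      fix q assume "q \<in> H - {p}"
      then have "card {p, q} = 2" by auto
      then show "card (hit q) \<le> fact (n - 2)"
        unfolding hit_def using card_permutations_containing_le[of n "{p, q}"] by simp
    qed
    also have "\<dots> \<le> s * fact (n - 2)" using card_Diff1_le[of H p] cH by simp
    finally have "card av \<le> card (K p) + card (derangements_at n (fst p) (snd p) - star p) + s * fact (n - 2)"
      by simp
    from of_nat_mono[OF this, where 'a = real]
    have ub: "real (card av) \<le> real (card (K p)) + D / 64 + real s * fact (n - 2)"
      using lost by simp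
    have "64 * (real s * fact (n - 2)) \<le> (fact (n - 1) :: real)"
    proof -
      have "real s * 1 \<le> real s * real b" using b by (intro mult_left_mono) auto
      then have "64 * real s \<le> real (n - 1)" using sb by linarith
      then have "64 * real s * fact (n - 2) \<le> real (n - 1) * fact (n - 2)" by (intro mult_right_mono) auto
      also have "\<dots> = fact (n - 1)"
      proof -
        have "n - 1 = Suc (n - 2)" using n by simp
        then show ?thesis by (metis fact_Suc)
      qed
      finally show ?thesis by simp
    qed
    then show ?thesis using ub av D_le by linarith
  qed
  have injA: "inj_on (\<lambda>\<pi>. G \<pi> - {p}) (K p)" for p
  proof (rule inj_onI)
    fix \<pi> \<tau> assume a: "\<pi> \<in> K p" "\<tau> \<in> K p" "G \<pi> - {p} = G \<tau> - {p}"
    moreover have "p \<in> G \<pi>" "p \<in> G \<tau>" "\<pi> \<in> F" "\<tau> \<in> F" using a(1,2) unfolding K_def star_def by auto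
    ultimately have "G \<pi> = G \<tau>" by blast
    then show "\<pi> = \<tau>" using inj_onD[OF inj_G_F] \<open>\<pi> \<in> F\<close> \<open>\<tau> \<in> F\<close> by blast
  qed
  have cA: "card (A p) = card (K p)" for p unfolding A_def using card_image[OF injA] .
  have "\<exists>R. (\<forall>p\<in>H. R p \<in> A p) \<and> (\<forall>p\<in>H. \<forall>q\<in>H. p \<noteq> q \<longrightarrow> R p \<inter> R q = {})"
  \<comment> \<open>\<open>L = 32\<close> comes from \<open>cK\<close>; \<open>\<rho>\<close> is
    what remains of the 30000 in \<open>sb\<close> after the 3 of the falling factorial.\<close>
  proof (rule rainbow_disjoint_sets[where X = X and L = 32 and \<rho> = "1 / 10000" and b = b and k = n])
    fix p assume p: "p \<in> H"
    show "A p \<subseteq> Pow X" unfolding A_def K_def star_def using perm_graph_subset F_permutes by blast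
    have "(0 :: real) < fact (n - 1)" by simp
    then have "0 < real (card (K p))" using cK[OF p] by linarith
    then show "A p \<noteq> {}" using cA[of p] by auto
    show "card S \<le> n" if S: "S \<in> A p" for S
    proof -
      obtain \<pi> where "S = G \<pi> - {p}" using S unfolding A_def by blast
      then show ?thesis using card_Diff1_le[of "G \<pi>" p] card_perm_graph[of n \<pi>] by simp
    qed
    fix Z assume Z: "Z \<subseteq> X" "Z \<noteq> {}"
    have finZ: "finite Z" using Z(1) by (rule finite_subset) simp
    show "real (card {S\<in>A p. Z \<subseteq> S}) * (real (card H) * real b) ^ card Z
       \<le> 32 * real (card (A p)) * (1 / 10000) ^ card Z"
    proof (cases "{S\<in>A p. Z \<subseteq> S} = {}")
      case True
      show ?thesis unfolding True by simp
    next
      case False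
      then obtain \<pi> where \<pi>: "\<pi> \<in> K p" "Z \<subseteq> G \<pi> - {p}" unfolding A_def by blast
      then have pZ: "p \<notin> Z" by blast
      have "insert p Z \<subseteq> G \<pi>" using \<pi> unfolding K_def star_def by blast
      then have "card (insert p Z) \<le> n"
        using card_mono[of "G \<pi>"] card_perm_graph[of n \<pi>] by (simp add: perm_graph_def)
      then have z: "card Z \<le> n - 1" using pZ finZ by simp
      have "{S\<in>A p. Z \<subseteq> S} \<subseteq> (\<lambda>\<pi>. G \<pi> - {p}) ` {\<pi>. \<pi> permutes {1..n} \<and> insert p Z \<subseteq> G \<pi>}"
        unfolding A_def K_def star_def using F_permutes by auto
      then have "card {S\<in>A p. Z \<subseteq> S} \<le> card {\<pi>. \<pi> permutes {1..n} \<and> insert p Z \<subseteq> G \<pi>}"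
        by (intro surj_card_le finite_permutes)
      also have "\<dots> \<le> fact (n - card (insert p Z))" by (rule card_permutations_containing_le)
      also have "n - card (insert p Z) = n - 1 - card Z" using pZ finZ by simp
      finally have "real (card {S\<in>A p. Z \<subseteq> S}) \<le> real (fact (n - 1 - card Z))" by (rule of_nat_mono)
      then have c: "real (card {S\<in>A p. Z \<subseteq> S}) \<le> fact (n - 1 - card Z)" by simp
      have "real (card H) * real b \<le> real s * real b" using cH by (intro mult_right_mono) auto
      then have "real (card H) * real b \<le> real (n - 1) / 3 * (1 / 10000)" using sb by linarith
      then have "(real (card H) * real b) ^ card Z \<le> (real (n - 1) / 3 * (1 / 10000)) ^ card Z"
        by (intro power_mono) auto
      also have "\<dots> = (real (n - 1) / 3) ^ card Z * (1 / 10000) ^ card Z" by (rule power_mult_distrib)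
      finally have "real (card {S\<in>A p. Z \<subseteq> S}) * (real (card H) * real b) ^ card Z
          \<le> fact (n - 1 - card Z) * ((real (n - 1) / 3) ^ card Z * (1 / 10000) ^ card Z)"
        using c by (intro mult_mono) auto
      also have "\<dots> = (fact (n - 1 - card Z) * (real (n - 1) / 3) ^ card Z) * (1 / 10000) ^ card Z"
        by (simp only: mult.assoc)
      also have "\<dots> \<le> fact (n - 1) * (1 / 10000) ^ card Z"
        using fact_diff_mult_power_le[OF z] by (intro mult_right_mono) auto
      also have "\<dots> \<le> 32 * real (card (A p)) * (1 / 10000) ^ card Z"
        using cK[OF p] cA[of p] by (intro mult_right_mono) auto
      finally show ?thesis .
    qed
  next
    have "real (card H) * ((3 / 5) ^ b * real n) \<le> real s * ((3 / 5) ^ b * real n)"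
      using cH by (intro mult_right_mono) auto
    then show "real (card H) * ((3 / 5) ^ b * real n) < 1" using small by linarith
  qed (use finH b in auto)
  then obtain R where "\<forall>p\<in>H. R p \<in> A p" "\<forall>p\<in>H. \<forall>q\<in>H. p \<noteq> q \<longrightarrow> R p \<inter> R q = {}"
    by (elim exE conjE) (rule that)
  note R = this[rule_format]
  have "\<forall>p\<in>H. \<exists>\<pi>. \<pi> \<in> K p \<and> R p = G \<pi> - {p}" using R(1) unfolding A_def by blast
  from bchoice[OF this] obtain f where f': "\<forall>p\<in>H. f p \<in> K p \<and> R p = G (f p) - {p}" by blast
  note f = bspec[OF f', THEN conjunct1] bspec[OF f', THEN conjunct2]
  have fG: "p \<in> G (f p)" "G (f p) \<inter> G \<sigma> = {}" "G (f p) \<inter> (H - {p}) = {}" "f p \<in> F" if "p \<in> H" for p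
    using f(1)[OF that] unfolding K_def star_def by auto
  have disj: "G (f p) \<inter> G (f q) = {}" if "p \<in> H" "q \<in> H" "p \<noteq> q" for p q
  proof -
    have "q \<notin> G (f p)" "p \<notin> G (f q)" using fG(3)[OF that(1)] fG(3)[OF that(2)] that by auto
    then show ?thesis using R(2)[OF that] f(2)[OF that(1)] f(2)[OF that(2)] by blast
  qed
  have injf: "inj_on f H" by (rule inj_onI) (metis disj fG(1) disjoint_iff)
  have \<sigma>f: "\<sigma> \<notin> f ` H"
  proof
    assume "\<sigma> \<in> f ` H"
    then obtain p where "p \<in> H" "\<sigma> = f p" by blast
    then show False using fG(1,2)[of p] by auto
  qed
  have "card (insert \<sigma> (f ` H)) < s"
  proof (rule matching_less)
    show "insert \<sigma> (f ` H) \<subseteq> F" using \<sigma>F fG(4) by auto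
    fix \<pi> \<tau> assume a: "\<pi> \<in> insert \<sigma> (f ` H)" "\<tau> \<in> insert \<sigma> (f ` H)" "\<pi> \<noteq> \<tau>"
    consider p q where "p \<in> H" "q \<in> H" "\<pi> = f p" "\<tau> = f q" | p where "p \<in> H" "\<pi> = f p" "\<tau> = \<sigma>"
      | p where "p \<in> H" "\<pi> = \<sigma>" "\<tau> = f p" using a by blast
    then show "G \<pi> \<inter> G \<tau> = {}"
    proof cases
      case 1
      then show ?thesis using disj[of p q] a(3) by auto
    next
      case 2
      then show ?thesis using fG(2)[of p] by simp
    next
      case 3
      then show ?thesis using fG(2)[of p] by (simp add: Int_commute)
    qed
  qed
  moreover have "card (insert \<sigma> (f ` H)) = s"
    using \<sigma>f finH card_image[OF injf] cH s by simp
  ultimately show False by simp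
qed

text \<open>Everything follows from the assumption that \<open>F\<close> has at least the claimed
  maximal size: this already makes \<open>F\<close> a union of \<open>s - 1\<close> stars, and the
  upper bound is read off from that union.\<close>

lemma union_of_stars:
  "card F \<le> (s - 1) * d1 n \<and> (card F = (s - 1) * d1 n \<longrightarrow>
    (\<exists>H. finite H \<and> card H = s - 1 \<and>
      (\<forall>p\<in>H. fst p \<in> {1..n} \<and> snd p \<in> {1..n} \<and> fst p \<noteq> snd p) \<and>
      (\<forall>p\<in>H. \<forall>q\<in>H. fst p = fst q \<or> snd p = snd q) \<and>
      F = (\<Union>p\<in>H. derangements_at n (fst p) (snd p))))"
proof (cases "card F < (s - 1) * d1 n")
  case False
  obtain H where HX: "H \<subseteq> X" and cHs: "card H < s" and
    F0: "real (card {\<pi>\<in>F. G \<pi> \<inter> H = {}}) \<le> real (s - 1 - card H) * (D / 2) + D / 64"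
    using core_stars by blast
  have finH: "finite H" using HX by (rule finite_subset) simp
  define F0 where "F0 = {\<pi>\<in>F. G \<pi> \<inter> H = {}}"
  have "card F = card (F0 \<union> (\<Union>p\<in>H. star p))" using stars_cover[of H] unfolding F0_def by simp
  also have "\<dots> \<le> card F0 + card (\<Union>p\<in>H. star p)" by (rule card_Un_le)
  also have "card (\<Union>p\<in>H. star p) \<le> (\<Sum>p\<in>H. card (star p))" using finH by (rule card_UN_le)
  finally have cF: "card F \<le> card F0 + (\<Sum>p\<in>H. card (star p))" by simp
  have sum_le: "(\<Sum>p\<in>P. card (star p)) \<le> card P * d1 n" for P
    using sum_bounded_above[of P "\<lambda>p. card (star p)" "d1 n"] card_star_le by simp
  have cH: "card H = s - 1"
  proof (rule ccontr)
    assume "card H \<noteq> s - 1"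
    \<comment> \<open>Missing stars cannot be made up for:
      \<open>u * D \<le> u * (D / 2) + D / 64\<close> fails as soon as
      \<open>u \<ge> 1\<close>.\<close>
    define u where "u = s - 1 - card H"
    have u: "s - 1 = card H + u" "1 \<le> u" using \<open>card H \<noteq> s - 1\<close> cHs unfolding u_def by auto
    have "(card H + u) * d1 n \<le> card F0 + card H * d1 n" using cF sum_le[of H] False u(1) by simp
    then have "u * d1 n \<le> card F0" by (simp add: add_mult_distrib)
    from of_nat_mono[OF this, where 'a = real] have "real u * D \<le> real (card F0)" by simp
    also have "\<dots> \<le> real u * (D / 2) + D / 64" using F0 unfolding F0_def u_def .
    finally have "real u * D \<le> D / 32" by (simp add: field_simps)
    moreover have "1 * D \<le> real u * D" using u D_pos by (intro mult_right_mono) auto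
    ultimately show False using D_pos by linarith
  qed
  have rest: "card F \<le> card F0 + (card (star p) + (s - 2) * d1 n)" if "p \<in> H" for p
  proof -
    have "(\<Sum>p\<in>H. card (star p)) = card (star p) + (\<Sum>p\<in>H - {p}. card (star p))"
      using finH that by (rule sum.remove)
    moreover have "(\<Sum>p\<in>H - {p}. card (star p)) \<le> (s - 2) * d1 n"
      using sum_le[of "H - {p}"] that cH finH by (simp add: card_Diff_singleton numeral_2_eq_2)
    ultimately show ?thesis using cF by linarith
  qed
  \<comment> \<open>The subtraction in \<open>s - 2\<close> is truncated; a centre in
    \<open>H\<close> guarantees \<open>s \<ge> 2\<close>.\<close>
  have split: "(s - 1) * d1 n = d1 n + (s - 2) * d1 n" if "p \<in> H" for p
  proof -
    have "0 < card H" using that finH by (auto simp: card_gt_0_iff)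
    then have "s - 1 = Suc (s - 2)" using cH by simp
    then show ?thesis by simp
  qed
  have F_stars: "F = (\<Union>p\<in>H. star p)"
  proof (rule all_in_stars[OF HX cH])
    fix p assume p: "p \<in> H"
    have "d1 n \<le> card F0 + card (star p)" using rest[OF p] split[OF p] False by linarith
    from of_nat_mono[OF this, where 'a = real] have "D \<le> real (card F0) + real (card (star p))" by simp
    moreover have "real (card F0) \<le> D / 64" using F0 cH unfolding F0_def by simp
    ultimately show "63 / 64 * D \<le> real (card (star p))" by linarith
  qed
  have F0e: "F0 = {}" using F_stars unfolding F0_def star_def by blast
  have star_eq: "star p = derangements_at n (fst p) (snd p)" and
    off: "fst p \<in> {1..n} \<and> snd p \<in> {1..n} \<and> fst p \<noteq> snd p" if p: "p \<in> H" for p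
  proof -
    have ge: "d1 n \<le> card (star p)" using rest[OF p] split[OF p] False F0e by simp
    then have "0 < card (star p)" using D_pos by linarith
    then have "star p \<noteq> {}" by auto
    then show o: "fst p \<in> {1..n} \<and> snd p \<in> {1..n} \<and> fst p \<noteq> snd p" using star_off_diagonal by blast
    then have "card (derangements_at n (fst p) (snd p)) = d1 n" by (intro card_derangements_at) auto
    then show "star p = derangements_at n (fst p) (snd p)"
      using ge by (intro card_seteq finite_derangements_at star_subset) simp
  qed
  have lines: "fst p = fst q \<or> snd p = snd q" if p: "p \<in> H" and q: "q \<in> H" for p q
  proof (rule ccontr)
    assume neg: "\<not> (fst p = fst q \<or> snd p = snd q)"
    then have pq: "p \<in> H - {q}" using p by auto
    have "star p \<inter> star q \<noteq> {}"
      using derangement_through_two_pairs[OF n] off[OF p] off[OF q] neg star_eq[OF p] star_eq[OF q] by metis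
    then obtain \<pi> where \<pi>: "\<pi> \<in> star p" "\<pi> \<in> star q" by blast
    have "F \<subseteq> (\<Union>p\<in>H - {q}. star p) \<union> (star q - {\<pi>})" using F_stars \<pi> pq by blast
    then have "card F \<le> card ((\<Union>p\<in>H - {q}. star p) \<union> (star q - {\<pi>}))"
      using finH finite_star by (intro card_mono) auto
    also have "\<dots> \<le> card (\<Union>p\<in>H - {q}. star p) + card (star q - {\<pi>})" by (rule card_Un_le)
    finally have "card F \<le> card (\<Union>p\<in>H - {q}. star p) + card (star q - {\<pi>})" .
    moreover have "card (\<Union>p\<in>H - {q}. star p) \<le> (\<Sum>p\<in>H - {q}. card (star p))"
      using finH by (intro card_UN_le) auto
    moreover have "(\<Sum>p\<in>H - {q}. card (star p)) \<le> (s - 2) * d1 n"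
      using sum_le[of "H - {q}"] q cH finH by (simp add: card_Diff_singleton numeral_2_eq_2)
    moreover have "card (star q - {\<pi>}) < card (star q)"
      using \<pi>(2) finite_star by (intro card_Diff1_less) auto
    ultimately show False using card_star_le[of q] split[OF q] False by linarith
  qed
  have "card F \<le> (s - 1) * d1 n" using cF F0e sum_le[of H] cH by simp
  moreover have "F = (\<Union>p\<in>H. derangements_at n (fst p) (snd p))" using F_stars star_eq by simp
  ultimately show ?thesis using finH cH off lines by blast
qed simp

end

text \<open>Two different cells of one row have different columns, so a cell outside this row cannot
  share its column with both.\<close>

lemma common_row_or_column:
  assumes "\<forall>p\<in>H. \<forall>q\<in>H. fst p = fst q \<or> snd p = snd q"
  shows "(\<exists>x. \<forall>p\<in>H. fst p = x) \<or> (\<exists>y. \<forall>p\<in>H. snd p = y)"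
  using assms by metis

theorem theorem5:
  fixes n :: nat and s :: int and F :: "(nat \<Rightarrow> nat) set"
  assumes hs: "real_of_int s \<le> real n / (2 ^ 17 * ln (real n))"
    and hF: "F \<subseteq> derangements n"
    and hnu: "int (nu n F) < s"
  shows "int (card F) \<le> (s - 1) * int (d1 n)
    \<and> (int (card F) = (s - 1) * int (d1 n) \<longrightarrow>
        (\<exists>x ys. x \<in> {1..n} \<and> inj_on ys {1..nat (s - 1)} \<and>
            (\<forall>i\<in>{1..nat (s - 1)}. ys i \<in> {1..n} \<and> ys i \<noteq> x) \<and>
            F = (\<Union>i\<in>{1..nat (s - 1)}. derangements_at n x (ys i)))
      \<or> (\<exists>y xs. y \<in> {1..n} \<and> inj_on xs {1..nat (s - 1)} \<and>
            (\<forall>i\<in>{1..nat (s - 1)}. xs i \<in> {1..n} \<and> xs i \<noteq> y) \<and>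
            F = (\<Union>i\<in>{1..nat (s - 1)}. derangements_at n (xs i) y)))"
proof -
  define t where "t = nat s"
  have s: "s = int t" and t: "1 \<le> t" using hnu unfolding t_def by auto
  have s1: "s - 1 = int (t - 1)" "nat (s - 1) = t - 1" using s t by auto
  have ht: "real t \<le> real n / (2 ^ 17 * ln (real n))" using hs s by simp
  interpret derangement_family n t "nat \<lceil>4 * ln (real n)\<rceil>" F
    using parameter_estimates[OF t ht] t hF hnu s by unfold_locales auto
  have le: "card F \<le> (t - 1) * d1 n" using union_of_stars by blast
  have eqn: "int (card F) = (s - 1) * int (d1 n) \<longleftrightarrow> card F = (t - 1) * d1 n"
    unfolding s1(1) by (metis of_nat_eq_iff of_nat_mult)
  have "(\<exists>x ys. x \<in> {1..n} \<and> inj_on ys {1..t - 1} \<and>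
            (\<forall>i\<in>{1..t - 1}. ys i \<in> {1..n} \<and> ys i \<noteq> x) \<and>
            F = (\<Union>i\<in>{1..t - 1}. derangements_at n x (ys i)))
      \<or> (\<exists>y xs. y \<in> {1..n} \<and> inj_on xs {1..t - 1} \<and>
            (\<forall>i\<in>{1..t - 1}. xs i \<in> {1..n} \<and> xs i \<noteq> y) \<and>
            F = (\<Union>i\<in>{1..t - 1}. derangements_at n (xs i) y))"
    if "card F = (t - 1) * d1 n"
  proof -
    obtain H where H: "finite H" "card H = t - 1"
      and off: "\<And>p. p \<in> H \<Longrightarrow> fst p \<in> {1..n} \<and> snd p \<in> {1..n} \<and> fst p \<noteq> snd p"
      and lines: "\<forall>p\<in>H. \<forall>q\<in>H. fst p = fst q \<or> snd p = snd q"
      and FH: "F = (\<Union>p\<in>H. derangements_at n (fst p) (snd p))"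
      using union_of_stars \<open>card F = (t - 1) * d1 n\<close> by blast
    obtain h where h: "bij_betw h {1..t - 1} H" using ex_bij_betw_nat_finite_1[OF H(1)] H(2) by metis
    have hH: "h i \<in> H" if "i \<in> {1..t - 1}" for i using h that by (rule bij_betwE[rule_format])
    have FU: "F = (\<Union>i\<in>{1..t - 1}. derangements_at n (fst (h i)) (snd (h i)))"
      unfolding FH bij_betw_imp_surj_on[OF h, symmetric] by simp
    have n1: "1 \<in> {1..n}" using n by simp
    have inj: "i = j" if "i \<in> {1..t - 1}" "j \<in> {1..t - 1}" "fst (h i) = fst (h j)" "snd (h i) = snd (h j)" for i j
      using inj_onD[OF bij_betw_imp_inj_on[OF h] prod_eqI[OF that(3,4)] that(1,2)] .
    from common_row_or_column[OF lines] show ?thesis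
    proof
      assume "\<exists>x. \<forall>p\<in>H. fst p = x"
      then obtain z where z: "\<forall>p\<in>H. fst p = z" by blast
      \<comment> \<open>If \<open>s = 1\<close> then \<open>H\<close> is empty and \<open>z\<close>
        is arbitrary, but a row in \<open>{1..n}\<close> still has to be named.\<close>
      define x where "x = (if H = {} then 1 else z)"
      have x: "fst p = x" if "p \<in> H" for p using that z unfolding x_def by auto
      have "x \<in> {1..n}" using n1 off x by (metis x_def equals0I)
      moreover have "inj_on (\<lambda>i. snd (h i)) {1..t - 1}"
        by (rule inj_onI, rule inj) (use hH x in auto)
      moreover have "\<forall>i\<in>{1..t - 1}. snd (h i) \<in> {1..n} \<and> snd (h i) \<noteq> x"
        using off hH x by metis
      moreover have "F = (\<Union>i\<in>{1..t - 1}. derangements_at n x (snd (h i)))"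
        unfolding FU using hH x by (intro SUP_cong refl) metis
      ultimately show ?thesis by (intro disjI1 exI[of _ x] exI[of _ "\<lambda>i. snd (h i)"]) blast
    next
      assume "\<exists>y. \<forall>p\<in>H. snd p = y"
      then obtain z where z: "\<forall>p\<in>H. snd p = z" by blast
      define y where "y = (if H = {} then 1 else z)"
      have y: "snd p = y" if "p \<in> H" for p using that z unfolding y_def by auto
      have "y \<in> {1..n}" using n1 off y by (metis y_def equals0I)
      moreover have "inj_on (\<lambda>i. fst (h i)) {1..t - 1}"
        by (rule inj_onI, rule inj) (use hH y in auto)
      moreover have "\<forall>i\<in>{1..t - 1}. fst (h i) \<in> {1..n} \<and> fst (h i) \<noteq> y"
        using off hH y by metis
      moreover have "F = (\<Union>i\<in>{1..t - 1}. derangements_at n (fst (h i)) y)"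
        unfolding FU using hH y by (intro SUP_cong refl) metis
      ultimately show ?thesis by (intro disjI2 exI[of _ y] exI[of _ "\<lambda>i. fst (h i)"]) blast
    qed
  qed
  moreover have "int (card F) \<le> (s - 1) * int (d1 n)"
    unfolding s1(1) using of_nat_mono[OF le, where 'a = int] by simp
  ultimately show ?thesis unfolding eqn s1(2) by blast
qed

end
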